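(* For every $n\geq 4$, the star graph $S_n$ is an independent element in the poset $\mathcal{E}_n$.
   Context: All graphs are finite and simple. The star $S_n$ ($n\ge4$) is the graph on vertex set $\{1,\dots,n\}$ whose edges join $n$ to each $j\in\{1,\dots,n-1\}$. The chromatic symmetric function of a graph $G$ with vertices $v_1,\dots,v_n$ is $X_G=\sum_{\kappa}x_{\kappa(v_1)}\cdots x_{\kappa(v_n)}$, summed over all proper colorings $\kappa:V(G)\to\{1,2,3,\dots\}$; it is a homogeneous symmetric function of degree $n$ over $\mathbb{Q}$. Let $e_\lambda=e_{\lambda_1}e_{\lambda_2}\cdots$ be the elementary symmetric functions; $[e_\lambda]F$ denotes the coefficient of $e_\lambda$ in $F$ expanded in this basis, and $F$ is $e$-positive if $[e_\lambda]F\ge 0$ for all $\lambda$. For connected graphs $G,H$ on $n$ vertices (for which $[e_{(n)}]X_G$ and $[e_{(n)}]X_H$ are positive), set $$X_e(G,H)=X_G-\frac{[e_{(n)}]X_G}{[e_{(n)}]X_H}X_H.$$ $\mathcal{E}_n$ is the poset whose elements are the equivalence classes of connected graphs on $n$ vertices under $G\sim H\iff X_G=X_H$, ordered by $G\geq_e H$ if and only if $X_e(G,H)$ is $e$-positive. An element of a poset is called independent if it is not comparable to any other element of the poset. *)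

theory Defs
  imports "Graph_Theory.Graph_Theory" "HOL-Library.Multiset" "HOL-Library.FuncSet"
begin

section \<open>Formal power series in countably many variables\<close>

text \<open>
  A monomial in the variables \<open>x\<^sub>i\<close> is encoded as the finite multiset of the indices of its
  variables, so that multiplication of monomials is addition of multisets.  A series is its
  family of rational coefficients.
\<close>

typedef series = "UNIV :: (nat multiset \<Rightarrow> rat) set"
  morphisms mcoeff Abs_series
  by simp

setup_lifting type_definition_series

lemma finite_msplits: "finite {(A, B). A + B = (M :: 'a multiset)}"
proof (induction M)
  case empty
  have "{(A, B). A + B = ({#} :: 'a multiset)} = {({#}, {#})}" by auto
  then show ?case by simp
next
  case (add x M)
  let ?S = "{(A, B). A + B = M}"
  have "{(A, B). A + B = add_mset x M}
      \<subseteq> (\<lambda>(A, B). (add_mset x A, B)) ` ?S \<union> (\<lambda>(A, B). (A, add_mset x B)) ` ?S"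
  proof clarify
    fix A B assume eq: "A + B = add_mset x M" and nB: "(A, B) \<notin> (\<lambda>(A, B). (A, add_mset x B)) ` ?S"
    have "x \<in># A \<or> x \<in># B"
      using eq by (metis union_iff union_single_eq_member)
    then show "(A, B) \<in> (\<lambda>(A, B). (add_mset x A, B)) ` ?S"
    proof
      assume "x \<in># A"
      then obtain A' where "A = add_mset x A'" by (meson multi_member_split)
      with eq show ?thesis by (intro image_eqI[of _ _ "(A', B)"]) auto
    next
      assume "x \<in># B"
      then obtain B' where "B = add_mset x B'" by (meson multi_member_split)
      with eq have "(A, B) \<in> (\<lambda>(A, B). (A, add_mset x B)) ` ?S"
        by (intro image_eqI[of _ _ "(A, B')"]) auto
      with nB show ?thesis by simp
    qed
  qed
  with add show ?case by (meson finite_UnI finite_imageI finite_subset)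
qed

instantiation series :: comm_ring_1
begin

lift_definition zero_series :: series is "\<lambda>_. 0" .
lift_definition one_series :: series is "\<lambda>M. if M = {#} then 1 else 0" .
lift_definition plus_series :: "series \<Rightarrow> series \<Rightarrow> series" is "\<lambda>f g M. f M + g M" .
lift_definition minus_series :: "series \<Rightarrow> series \<Rightarrow> series" is "\<lambda>f g M. f M - g M" .
lift_definition uminus_series :: "series \<Rightarrow> series" is "\<lambda>f M. - f M" .
lift_definition times_series :: "series \<Rightarrow> series \<Rightarrow> series"
  is "\<lambda>f g M. \<Sum>(A, B) | A + B = M. f A * g B" .

instance
proof
  fix f g h :: series
  show "f * g * h = f * (g * h)"
  proof transfer
    fix f g h :: "nat multiset \<Rightarrow> rat"
    show "(\<lambda>M. \<Sum>(D, C) | D + C = M. (\<Sum>(A, B) | A + B = D. f A * g B) * h C)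
        = (\<lambda>M. \<Sum>(A, D) | A + D = M. f A * (\<Sum>(B, C) | B + C = D. g B * h C))"
    proof
      fix M :: "nat multiset"
      have "(\<Sum>(D, C) | D + C = M. (\<Sum>(A, B) | A + B = D. f A * g B) * h C)
          = (\<Sum>p\<in>{(D, C). D + C = M}. \<Sum>q\<in>{(A, B). A + B = fst p}.
               f (fst q) * g (snd q) * h (snd p))"
        by (simp add: case_prod_unfold sum_distrib_right)
      also have "\<dots> = (\<Sum>(p, q)\<in>(SIGMA p:{(D, C). D + C = M}. {(A, B). A + B = fst p}).
               f (fst q) * g (snd q) * h (snd p))"
        by (subst sum.Sigma) (auto simp: finite_msplits)
      also have "\<dots> = (\<Sum>(p, q)\<in>(SIGMA p:{(A, D). A + D = M}. {(B, C). B + C = snd p}).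
               f (fst p) * (g (fst q) * h (snd q)))"
        by (rule sum.reindex_bij_witness[where
              i = "\<lambda>((A, D), (B, C)). ((A + B, C), (A, B))" and
              j = "\<lambda>((D, C), (A, B)). ((A, B + C), (B, C))"])
           (auto simp: add_ac)
      also have "\<dots> = (\<Sum>p\<in>{(A, D). A + D = M}. \<Sum>q\<in>{(B, C). B + C = snd p}.
               f (fst p) * (g (fst q) * h (snd q)))"
        by (subst sum.Sigma) (auto simp: finite_msplits)
      also have "\<dots> = (\<Sum>(A, D) | A + D = M. f A * (\<Sum>(B, C) | B + C = D. g B * h C))"
        by (simp add: case_prod_unfold sum_distrib_left)
      finally show "(\<Sum>(D, C) | D + C = M. (\<Sum>(A, B) | A + B = D. f A * g B) * h C)
          = (\<Sum>(A, D) | A + D = M. f A * (\<Sum>(B, C) | B + C = D. g B * h C))" .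
    qed
  qed
  show "f * g = g * f"
  proof transfer
    fix f g :: "nat multiset \<Rightarrow> rat"
    show "(\<lambda>M. \<Sum>(A, B) | A + B = M. f A * g B) = (\<lambda>M. \<Sum>(A, B) | A + B = M. g A * f B)"
      by (intro ext sum.reindex_bij_witness[where i = prod.swap and j = prod.swap])
         (auto simp: add_ac)
  qed
  show "1 * f = f"
  proof transfer
    fix f :: "nat multiset \<Rightarrow> rat"
    show "(\<lambda>M. \<Sum>(A, B) | A + B = M. (if A = {#} then 1 else 0) * f B) = f"
    proof
      fix M :: "nat multiset"
      have "(\<Sum>(A, B) | A + B = M. (if A = {#} then 1 else 0) * f B)
          = (\<Sum>(A, B)\<in>{({#} :: nat multiset, M)}. (if A = {#} then 1 else 0) * f B)"
        by (rule sum.mono_neutral_right) (auto simp: finite_msplits split: if_splits)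
      then show "(\<Sum>(A, B) | A + B = M. (if A = {#} then 1 else 0) * f B) = f M"
        by simp
    qed
  qed
  show "(f + g) * h = f * h + g * h"
    by transfer (simp add: fun_eq_iff case_prod_unfold distrib_right sum.distrib)
  show "(0 :: series) \<noteq> 1"
    by transfer (auto simp: fun_eq_iff)
qed (transfer; simp add: fun_eq_iff)+

end

lift_definition smult_series :: "rat \<Rightarrow> series \<Rightarrow> series" (infixr "*\<^sub>s" 75)
  is "\<lambda>c f M. c * f M" .


section \<open>Elementary symmetric functions\<close>

text \<open>The variables are \<open>x\<^sub>1, x\<^sub>2, \<dots>\<close>; the index \<open>0\<close> is not used.\<close>

lift_definition elem_sym :: "nat \<Rightarrow> series"
  is "\<lambda>k M. if \<exists>S\<subseteq>{1..}. finite S \<and> card S = k \<and> M = mset_set S then 1 else 0" .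

text \<open>Partitions are multisets of positive integers.\<close>

definition is_partition :: "nat multiset \<Rightarrow> bool" where
  "is_partition lam \<longleftrightarrow> 0 \<notin># lam"

definition e_basis :: "nat multiset \<Rightarrow> series" where
  "e_basis lam = (\<Prod>k\<in>#lam. elem_sym k)"

definition e_expansion :: "series \<Rightarrow> (nat multiset \<Rightarrow> rat) \<Rightarrow> bool" where
  "e_expansion F c \<longleftrightarrow>
     finite {lam. c lam \<noteq> 0} \<and> (\<forall>lam. c lam \<noteq> 0 \<longrightarrow> is_partition lam) \<and>
     F = (\<Sum>lam | c lam \<noteq> 0. c lam *\<^sub>s e_basis lam)"

text \<open>
  The expansion exists and is unique because the \<open>e_basis lam\<close> form a basis of the symmetric
  functions; the value is meaningful only for symmetric \<open>F\<close> of bounded degree.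
\<close>

definition e_coeff :: "nat multiset \<Rightarrow> series \<Rightarrow> rat" where
  "e_coeff lam F = (THE c. e_expansion F c) lam"

definition e_positive :: "series \<Rightarrow> bool" where
  "e_positive F \<longleftrightarrow> (\<forall>lam. is_partition lam \<longrightarrow> 0 \<le> e_coeff lam F)"


section \<open>Chromatic symmetric functions\<close>

text \<open>
  A finite simple graph is a \<open>pair_graph\<close>: a finite loop-free digraph whose arc set is a
  symmetric relation, each edge being represented by its two arcs.
\<close>

definition proper_colorings :: "'a pair_pre_digraph \<Rightarrow> ('a \<Rightarrow> nat) set" where
  "proper_colorings G =
     {\<kappa> \<in> pverts G \<rightarrow>\<^sub>E {1..}. \<forall>(u, v) \<in> parcs G. \<kappa> u \<noteq> \<kappa> v}"

text \<open>
  The coefficient of a monomial \<open>M\<close> in the sum of \<open>\<Prod>v. x\<^bsub>\<kappa> v\<^esub>\<close> over the (infinitely many)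
  proper colorings is the number of those \<open>\<kappa>\<close> whose monomial is \<open>M\<close>.
\<close>

lift_definition csf :: "'a pair_pre_digraph \<Rightarrow> series"
  is "\<lambda>G M. of_nat (card {\<kappa> \<in> proper_colorings G. image_mset \<kappa> (mset_set (pverts G)) = M})" .

definition X_e :: "'a pair_pre_digraph \<Rightarrow> 'a pair_pre_digraph \<Rightarrow> series" where
  "X_e G H = csf G -
     (e_coeff {#card (pverts G)#} (csf G) / e_coeff {#card (pverts H)#} (csf H)) *\<^sub>s csf H"


section \<open>The poset of connected graphs\<close>

text \<open>
  Vertices are taken to be natural numbers, which covers every finite graph up to isomorphism.
\<close>

definition conn_graphs :: "nat \<Rightarrow> nat pair_pre_digraph set" where
  "conn_graphs n =
     {G. pair_graph G \<and> Digraph_Component.connected (with_proj G) \<and> card (pverts G) = n}"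

definition csf_equiv :: "nat \<Rightarrow> nat pair_pre_digraph rel" where
  "csf_equiv n = {(G, H). G \<in> conn_graphs n \<and> H \<in> conn_graphs n \<and> csf G = csf H}"

lemma equiv_csf_equiv: "equiv (conn_graphs n) (csf_equiv n)"
  by (rule equivI) (auto simp: csf_equiv_def refl_on_def sym_def trans_def)

definition E_elements :: "nat \<Rightarrow> nat pair_pre_digraph set set" where
  "E_elements n = conn_graphs n // csf_equiv n"

text \<open>Pairs \<open>(a, b)\<close> with \<open>a \<le>\<^sub>e b\<close>; the condition does not depend on the representatives.\<close>

definition E_order :: "nat \<Rightarrow> nat pair_pre_digraph set rel" where
  "E_order n = {(a, b). a \<in> E_elements n \<and> b \<in> E_elements n \<and>
     (\<exists>H\<in>a. \<exists>G\<in>b. e_positive (X_e G H))}"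

lemma E_order_class_iff:
  assumes "G \<in> conn_graphs n" "H \<in> conn_graphs n"
  shows "(csf_equiv n `` {H}, csf_equiv n `` {G}) \<in> E_order n \<longleftrightarrow> e_positive (X_e G H)"
proof -
  have X_eq: "X_e G' H' = X_e G H"
    if "G' \<in> csf_equiv n `` {G}" "H' \<in> csf_equiv n `` {H}" for G' H'
    using that by (auto simp: csf_equiv_def X_e_def conn_graphs_def)
  have self: "G \<in> csf_equiv n `` {G}" "H \<in> csf_equiv n `` {H}"
    using assms by (auto simp: csf_equiv_def)
  have mem: "csf_equiv n `` {G} \<in> E_elements n" "csf_equiv n `` {H} \<in> E_elements n"
    unfolding E_elements_def using assms by (auto intro: quotientI)
  show ?thesis
  proof
    assume "(csf_equiv n `` {H}, csf_equiv n `` {G}) \<in> E_order n"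
    then obtain G' H' where "G' \<in> csf_equiv n `` {G}" "H' \<in> csf_equiv n `` {H}"
      "e_positive (X_e G' H')"
      unfolding E_order_def by blast
    then show "e_positive (X_e G H)" using X_eq by metis
  next
    assume "e_positive (X_e G H)"
    with self mem show "(csf_equiv n `` {H}, csf_equiv n `` {G}) \<in> E_order n"
      unfolding E_order_def by blast
  qed
qed

definition independent_element :: "'b set \<Rightarrow> 'b rel \<Rightarrow> 'b \<Rightarrow> bool" where
  "independent_element A r x \<longleftrightarrow>
     x \<in> A \<and> (\<forall>y\<in>A. y \<noteq> x \<longrightarrow> (x, y) \<notin> r \<and> (y, x) \<notin> r)"

definition star_graph :: "nat \<Rightarrow> nat pair_pre_digraph" where
  "star_graph n = \<lparr>pverts = {1..n}, parcs = {n} \<times> {1..n-1} \<union> {1..n-1} \<times> {n}\<rparr>"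

end

theory Submission
  imports Defs
begin

text \<open>
  Write \<open>X\<^sub>G\<close> as the sum of \<open>(-1)\<^bsup>|S|\<^esup> p\<^bsub>\<lambda>(S)\<^esub>\<close> over the edge sets \<open>S\<close> of \<open>G\<close>, where \<open>\<lambda>(S)\<close> lists the
  sizes of the components of \<open>S\<close>.  The coefficient of \<open>e\<^bsub>(n)\<^esub>\<close> only sees \<open>p\<^sub>n\<close>, and for \<open>a + b = n\<close> a
  combination \<open>[e\<^bsub>(a,b)\<^esub>] - r [e\<^bsub>(n)\<^esub>]\<close> with \<open>r\<close> independent of \<open>G\<close> only sees \<open>p\<^sub>a p\<^sub>b\<close>.  By
  deletion-contraction both functionals are nonnegative on \<open>X\<^sub>G\<close>; the first is positive on connected
  graphs, and the second is positive when the vertices split into two connected parts of sizes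
  \<open>a\<close> and \<open>b\<close>.

  A connected graph \<open>H\<close> on \<open>n \<ge> 4\<close> vertices that is not a star has two disjoint edges.  They grow
  into a splitting of \<open>H\<close> into connected parts of sizes \<open>a, b \<ge> 2\<close>, whereas in the star every edge set
  has at most one component of size at least 2, so the second functional vanishes there.  Hence \<open>e\<^bsub>(a,b)\<^esub>\<close> has
  a negative coefficient in \<open>X\<^sub>e(S\<^sub>n, H)\<close>.  Conversely the coefficient of \<open>e\<^bsub>(2,1,...,1)\<^esub>\<close> is that of the
  monomial \<open>x\<^sub>1\<^bsup>n-1\<^esup> x\<^sub>2\<close>, which is positive for the star and 0 for \<open>H\<close>; hence it is negative in
  \<open>X\<^sub>e(H, S\<^sub>n)\<close>.
\<close>

section \<open>Expansions in elementary symmetric functions\<close>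

lemma series_eqI: "(\<And>M. mcoeff F M = mcoeff G M) \<Longrightarrow> F = G"
  by (metis mcoeff_inject ext)

lemma mcoeff_sum: "mcoeff (sum f A) M = (\<Sum>x\<in>A. mcoeff (f x) M)"
  by (induction A rule: infinite_finite_induct) (simp_all add: zero_series.rep_eq plus_series.rep_eq)

lemma smult_series_mult: "(a *\<^sub>s F) * (b *\<^sub>s G) = (a * b) *\<^sub>s (F * G)"
  by (rule series_eqI)
     (simp add: smult_series.rep_eq times_series.rep_eq case_prod_unfold sum_distrib_left mult_ac)

lemma smult_series_distrib: "a *\<^sub>s (F + G) = a *\<^sub>s F + a *\<^sub>s G"
  by (rule series_eqI) (simp add: smult_series.rep_eq plus_series.rep_eq distrib_left)

lemma smult_series_add_left: "(a + b) *\<^sub>s F = a *\<^sub>s F + b *\<^sub>s F"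
  by (rule series_eqI) (simp add: smult_series.rep_eq plus_series.rep_eq distrib_right)

lemma smult_series_assoc: "a *\<^sub>s (b *\<^sub>s F) = (a * b) *\<^sub>s F"
  by (rule series_eqI) (simp add: smult_series.rep_eq)

lemma smult_series_0 [simp]: "0 *\<^sub>s F = 0" "a *\<^sub>s 0 = 0" "1 *\<^sub>s F = F"
  by (rule series_eqI; simp add: smult_series.rep_eq zero_series.rep_eq)+

lemma smult_series_sum: "a *\<^sub>s sum f A = (\<Sum>x\<in>A. a *\<^sub>s f x)"
  by (induction A rule: infinite_finite_induct) (simp_all add: smult_series_distrib)

lemma smult_series_sum_left: "sum f A *\<^sub>s F = (\<Sum>x\<in>A. f x *\<^sub>s F)"
  by (induction A rule: infinite_finite_induct) (simp_all add: smult_series_add_left)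

lemma mcoeff_times_nonzero:
  assumes "mcoeff (F * G) M \<noteq> 0"
  obtains A B where "M = A + B" "mcoeff F A \<noteq> 0" "mcoeff G B \<noteq> 0"
proof -
  obtain p where "p \<in> {(A, B). A + B = M}" "(case p of (A, B) \<Rightarrow> mcoeff F A * mcoeff G B) \<noteq> 0"
    using assms by (metis (no_types, lifting) sum.neutral times_series.rep_eq)
  then show thesis using that by (cases p) auto
qed

section \<open>Leading monomials and triangularity\<close>

text \<open>Among the monomials of \<open>e_basis lam\<close> this is the only one with the least sum of indices, which
  makes the \<open>e_basis lam\<close> triangular with respect to that sum.\<close>

definition lead_mono :: "nat multiset \<Rightarrow> nat multiset" where
  "lead_mono lam = (\<Sum>k\<in>#lam. mset_set {1..k})"

lemma lead_mono_simps [simp]: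
  "lead_mono {#} = {#}" "lead_mono (add_mset k lam) = mset_set {1..k} + lead_mono lam"
  by (simp_all add: lead_mono_def)

text \<open>Remove the maximum: among \<open>k + 1\<close> distinct positive integers it is at least
  \<open>k + 1\<close>, and induction bounds the rest. Equality in the total forces equality in both
  bounds.\<close>

lemma sum_positive_set_ge:
  fixes S :: "nat set"
  assumes "finite S" "S \<subseteq> {1..}"
  shows "\<Sum>{1..card S} \<le> \<Sum>S \<and> (\<Sum>S = \<Sum>{1..card S} \<longrightarrow> S = {1..card S})"
  using assms
proof (induction "card S" arbitrary: S)
  case 0
  then show ?case by simp
next
  case (Suc k)
  define m where "m = Max S"
  have ne: "S \<noteq> {}" using Suc by auto
  have m: "m \<in> S" unfolding m_def using Suc ne by simp
  have "S \<subseteq> {1..m}" using Suc.prems by (auto simp: m_def)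
  then have "card S \<le> m" using card_mono[of "{1..m}" S] by simp
  then have km: "Suc k \<le> m" using Suc by simp
  have c: "k = card (S - {m})" using Suc m by simp
  have IH: "\<Sum>{1..k} \<le> \<Sum>(S - {m})" "\<Sum>(S - {m}) = \<Sum>{1..k} \<longrightarrow> S - {m} = {1..k}"
    using Suc.hyps(1)[OF c] Suc.prems c[symmetric] by auto
  have S: "\<Sum>S = m + \<Sum>(S - {m})" using m Suc.prems by (simp add: sum.remove)
  have T: "\<Sum>{1..Suc k} = Suc k + \<Sum>{1..k}" by simp
  have "\<Sum>S = \<Sum>{1..Suc k} \<longrightarrow> S = {1..Suc k}"
  proof
    assume "\<Sum>S = \<Sum>{1..Suc k}"
    then have "m = Suc k" "S - {m} = {1..k}" using S T IH km by auto
    then show "S = {1..Suc k}" using m by (auto simp: atLeastAtMostSuc_conv)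
  qed
  moreover have "\<Sum>{1..Suc k} \<le> \<Sum>S" using S T IH km by linarith
  ultimately show ?case using Suc.hyps(2) by simp
qed

lemma elem_sym_mcoeff_nonzero:
  assumes "mcoeff (elem_sym k) M \<noteq> 0"
  shows "size M = k" "\<Sum>\<^sub># (mset_set {1..k}) \<le> \<Sum>\<^sub># M"
    "\<Sum>\<^sub># M = \<Sum>\<^sub># (mset_set {1..k}) \<Longrightarrow> M = mset_set {1..k}"
proof -
  obtain S where S: "S \<subseteq> {1..}" "finite S" "card S = k" "M = mset_set S"
    using assms by (auto simp: elem_sym.rep_eq split: if_splits)
  have *: "\<Sum>\<^sub># (mset_set T) = \<Sum>T" for T :: "nat set"
    using sum_unfold_sum_mset[of "\<lambda>x. x" T] by simp
  show "size M = k" "\<Sum>\<^sub># (mset_set {1..k}) \<le> \<Sum>\<^sub># M"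
    "\<Sum>\<^sub># M = \<Sum>\<^sub># (mset_set {1..k}) \<Longrightarrow> M = mset_set {1..k}"
    using S sum_positive_set_ge[of S] by (auto simp: *)
qed

lemma e_basis_simps [simp]:
  "e_basis {#} = 1" "e_basis (add_mset k lam) = elem_sym k * e_basis lam"
  by (simp_all add: e_basis_def)

lemma e_basis_plus: "e_basis (lam + mu) = e_basis lam * e_basis mu"
  by (simp add: e_basis_def)

text \<open>Size and index sum are additive over a product of monomials, so the minimum is attained
  only when every factor attains its own.\<close>

lemma e_basis_mcoeff_nonzero:
  assumes "mcoeff (e_basis lam) M \<noteq> 0"
  shows "size M = \<Sum>\<^sub># lam \<and> \<Sum>\<^sub># (lead_mono lam) \<le> \<Sum>\<^sub># M \<and>
    (\<Sum>\<^sub># M = \<Sum>\<^sub># (lead_mono lam) \<longrightarrow> M = lead_mono lam)"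
  using assms
proof (induction lam arbitrary: M)
  case empty
  then show ?case by (simp add: one_series.rep_eq split: if_splits)
next
  case (add k lam)
  then obtain A B where AB: "M = A + B" "mcoeff (elem_sym k) A \<noteq> 0" "mcoeff (e_basis lam) B \<noteq> 0"
    by (auto elim: mcoeff_times_nonzero)
  show ?case using elem_sym_mcoeff_nonzero[OF AB(2)] add.IH[OF AB(3)] AB(1) by auto
qed

text \<open>Only one splitting of the leading monomial contributes: neither factor can go below its
  own minimal index sum, so both must attain it.\<close>

lemma e_basis_mcoeff_lead: "mcoeff (e_basis lam) (lead_mono lam) = 1"
proof (induction lam)
  case empty
  then show ?case by (simp add: one_series.rep_eq)
next
  case (add k lam)
  let ?E = "mset_set {1..k}"
  have "mcoeff (e_basis (add_mset k lam)) (lead_mono (add_mset k lam))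
      = (\<Sum>(A, B) | A + B = ?E + lead_mono lam. mcoeff (elem_sym k) A * mcoeff (e_basis lam) B)"
    by (simp add: times_series.rep_eq)
  also have "\<dots> = (\<Sum>(A, B)\<in>{(?E, lead_mono lam)}. mcoeff (elem_sym k) A * mcoeff (e_basis lam) B)"
  proof (rule sum.mono_neutral_right)
    show "\<forall>p\<in>{(A, B). A + B = ?E + lead_mono lam} - {(?E, lead_mono lam)}.
      (case p of (A, B) \<Rightarrow> mcoeff (elem_sym k) A * mcoeff (e_basis lam) B) = 0"
    proof (rule ballI, rule ccontr)
      fix p
      assume p: "p \<in> {(A, B). A + B = ?E + lead_mono lam} - {(?E, lead_mono lam)}"
        and nz: "(case p of (A, B) \<Rightarrow> mcoeff (elem_sym k) A * mcoeff (e_basis lam) B) \<noteq> 0"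
      obtain A B where pAB: "p = (A, B)" by (cases p)
      have eq: "A + B = ?E + lead_mono lam" and ne: "(A, B) \<noteq> (?E, lead_mono lam)"
        using p unfolding pAB by blast+
      have "mcoeff (elem_sym k) A \<noteq> 0" "mcoeff (e_basis lam) B \<noteq> 0"
        using nz unfolding pAB by auto
      note * = elem_sym_mcoeff_nonzero[OF this(1)] e_basis_mcoeff_nonzero[OF this(2)]
      have "\<Sum>\<^sub># A + \<Sum>\<^sub># B = \<Sum>\<^sub># ?E + \<Sum>\<^sub># (lead_mono lam)"
        using arg_cong[OF eq, of sum_mset] by simp
      then have "A = ?E" "B = lead_mono lam" using * by auto
      then show False using ne by simp
    qed
  qed (auto simp: finite_msplits)
  also have "\<dots> = mcoeff (elem_sym k) ?E" using add by simp
  also have "\<dots> = 1" by (auto simp: elem_sym.rep_eq intro!: exI[of _ "{1..k}"])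
  finally show ?case .
qed

text \<open>The exponents of the leading monomial are the parts of the conjugate partition;
  differences of consecutive ones give back the multiplicities in \<open>lam\<close>.\<close>

lemma count_lead_mono:
  assumes "i \<ge> 1"
  shows "count (lead_mono lam) i = size {#k \<in># lam. i \<le> k#}"
  using assms by (induction lam) auto

lemma count_eq_lead_mono:
  assumes "k \<ge> 1"
  shows "count lam k + count (lead_mono lam) (Suc k) = count (lead_mono lam) k"
proof -
  have "size {#j \<in># lam. k \<le> j#} = count lam k + size {#j \<in># lam. Suc k \<le> j#}"
    by (induction lam) auto
  then show ?thesis using assms by (simp add: count_lead_mono)
qed

text \<open>Parts equal to 0 leave no trace in the leading monomial, which is why both arguments
  have to be partitions.\<close>

lemma lead_mono_inj:
  assumes "is_partition lam" "is_partition mu" "lead_mono lam = lead_mono mu"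
  shows "lam = mu"
proof (rule multiset_eqI)
  fix k
  show "count lam k = count mu k"
  proof (cases "k = 0")
    case True
    then show ?thesis using assms by (simp add: is_partition_def not_in_iff)
  next
    case False
    then show ?thesis
      using count_eq_lead_mono[of k lam] count_eq_lead_mono[of k mu] assms(3) by simp
  qed
qed

text \<open>Among the partitions with nonzero coefficient choose one whose leading monomial has
  least index sum. No other of them contributes to that monomial, so nothing cancels it.\<close>

lemma e_basis_independent:
  assumes fin: "finite K" and part: "\<And>lam. lam \<in> K \<Longrightarrow> is_partition lam"
    and zero: "(\<Sum>lam\<in>K. c lam *\<^sub>s e_basis lam) = 0" and "mu \<in> K"
  shows "c mu = 0"
proof (rule ccontr)
  assume "c mu \<noteq> 0"
  define L where "L = {lam \<in> K. c lam \<noteq> 0}"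
  have "finite L" "L \<noteq> {}" using fin \<open>mu \<in> K\<close> \<open>c mu \<noteq> 0\<close> by (auto simp: L_def)
  then obtain nu where nu: "nu \<in> L"
    and min: "\<And>lam. lam \<in> L \<Longrightarrow> \<Sum>\<^sub># (lead_mono nu) \<le> \<Sum>\<^sub># (lead_mono lam)"
    using ex_is_arg_min_if_finite[of L "\<lambda>lam. \<Sum>\<^sub># (lead_mono lam)"]
    by (auto simp: is_arg_min_linorder)
  have "0 = (\<Sum>lam\<in>K. c lam * mcoeff (e_basis lam) (lead_mono nu))"
    using arg_cong[OF zero, of "\<lambda>F. mcoeff F (lead_mono nu)"]
    by (simp add: mcoeff_sum smult_series.rep_eq zero_series.rep_eq)
  also have "\<dots> = (\<Sum>lam\<in>{nu}. c lam * mcoeff (e_basis lam) (lead_mono nu))"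
  proof (rule sum.mono_neutral_right)
    show "\<forall>lam\<in>K - {nu}. c lam * mcoeff (e_basis lam) (lead_mono nu) = 0"
    proof (rule ballI, rule ccontr)
      fix lam assume lam: "lam \<in> K - {nu}"
        and nz: "c lam * mcoeff (e_basis lam) (lead_mono nu) \<noteq> 0"
      then have "lam \<in> L" by (auto simp: L_def)
      have "mcoeff (e_basis lam) (lead_mono nu) \<noteq> 0" using nz by simp
      from e_basis_mcoeff_nonzero[OF this] min[OF \<open>lam \<in> L\<close>]
      have "lead_mono nu = lead_mono lam" by auto
      then show False
        using lead_mono_inj[of nu lam] part nu lam \<open>lam \<in> L\<close> by (auto simp: L_def)
    qed
  qed (use fin nu in \<open>auto simp: L_def\<close>)
  also have "\<dots> = c nu" by (simp add: e_basis_mcoeff_lead)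
  finally show False using nu by (auto simp: L_def)
qed

section \<open>Uniqueness and algebra of expansions\<close>

text \<open>The index set may be any finite superset of the support, so that several expansions can
  be combined over a common set.\<close>

lemma e_expansionI:
  assumes "finite K" "\<And>lam. lam \<in> K \<Longrightarrow> c lam \<noteq> 0 \<Longrightarrow> is_partition lam"
    and "\<And>lam. c lam \<noteq> 0 \<Longrightarrow> lam \<in> K" and "F = (\<Sum>lam\<in>K. c lam *\<^sub>s e_basis lam)"
  shows "e_expansion F c"
proof -
  have sub: "{lam. c lam \<noteq> 0} \<subseteq> K" using assms by auto
  have "F = (\<Sum>lam | c lam \<noteq> 0. c lam *\<^sub>s e_basis lam)"
    unfolding assms(4) by (rule sum.mono_neutral_right) (use sub assms(1) in auto)
  then show ?thesis
    unfolding e_expansion_def using sub assms by (auto intro: finite_subset)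
qed

lemma e_expansionD:
  assumes "e_expansion F c" "finite K" "\<And>lam. c lam \<noteq> 0 \<Longrightarrow> lam \<in> K"
  shows "F = (\<Sum>lam\<in>K. c lam *\<^sub>s e_basis lam)"
proof -
  have "F = (\<Sum>lam | c lam \<noteq> 0. c lam *\<^sub>s e_basis lam)"
    using assms(1) by (simp add: e_expansion_def)
  also have "\<dots> = (\<Sum>lam\<in>K. c lam *\<^sub>s e_basis lam)"
    by (rule sum.mono_neutral_left) (use assms(2,3) in auto)
  finally show ?thesis .
qed

lemma e_expansion_support:
  assumes "e_expansion F c" "K = {lam. c lam \<noteq> 0}"
  shows "finite K" "lam \<in> K \<Longrightarrow> is_partition lam" "c lam \<noteq> 0 \<longleftrightarrow> lam \<in> K"
    "F = (\<Sum>lam\<in>K. c lam *\<^sub>s e_basis lam)"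
  using assms unfolding e_expansion_def by blast+

lemma e_expansion_add:
  assumes "e_expansion F c" "e_expansion G d"
  shows "e_expansion (F + G) (\<lambda>lam. c lam + d lam)"
proof -
  define K where "K = {lam. c lam \<noteq> 0}"
  note K = e_expansion_support[OF assms(1) K_def]
  define L where "L = {lam. d lam \<noteq> 0}"
  note L = e_expansion_support[OF assms(2) L_def]
  have F: "F = (\<Sum>lam\<in>K \<union> L. c lam *\<^sub>s e_basis lam)"
    by (rule e_expansionD[OF assms(1)]) (simp_all add: K(1,3) L(1))
  have G: "G = (\<Sum>lam\<in>K \<union> L. d lam *\<^sub>s e_basis lam)"
    by (rule e_expansionD[OF assms(2)]) (simp_all add: K(1) L(1,3))
  have FG: "F + G = (\<Sum>lam\<in>K \<union> L. (c lam + d lam) *\<^sub>s e_basis lam)"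
    by (subst F, subst G) (simp add: smult_series_add_left sum.distrib)
  show ?thesis
  proof (rule e_expansionI[OF _ _ _ FG])
    show "lam \<in> K \<union> L" if "c lam + d lam \<noteq> 0" for lam
      using that K(3)[of lam] L(3)[of lam] by (cases "c lam = 0") auto
  qed (use K(1,2) L(1,2) in auto)
qed

lemma e_expansion_smult:
  assumes "e_expansion F c"
  shows "e_expansion (a *\<^sub>s F) (\<lambda>lam. a * c lam)"
proof -
  define K where "K = {lam. c lam \<noteq> 0}"
  note K = e_expansion_support[OF assms(1) K_def]
  have "a *\<^sub>s F = (\<Sum>lam\<in>K. (a * c lam) *\<^sub>s e_basis lam)"
    unfolding K(4) by (simp add: smult_series_sum smult_series_assoc)
  then show ?thesis by (rule e_expansionI[rotated 3]) (use K in auto)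
qed

lemma e_expansion_zero: "e_expansion 0 (\<lambda>_. 0)"
  by (simp add: e_expansion_def)

lemma e_expansion_one: "e_expansion 1 (\<lambda>lam. if lam = {#} then 1 else 0)"
  by (rule e_expansionI[of "{{#}}"]) (auto simp: is_partition_def split: if_splits)

lemma e_expansion_elem_sym:
  assumes "k \<ge> 1"
  shows "e_expansion (elem_sym k) (\<lambda>lam. if lam = {#k#} then 1 else 0)"
  by (rule e_expansionI[of "{{#k#}}"]) (use assms in \<open>auto simp: is_partition_def split: if_splits\<close>)

text \<open>Since \<open>e_basis\<close> is multiplicative, coefficients convolve: the pairs of
  partitions are grouped by their multiset sum.\<close>

lemma e_expansion_mult:
  assumes "e_expansion F c" "e_expansion G d"
  shows "e_expansion (F * G) (\<lambda>lam. \<Sum>(A, B) | A + B = lam. c A * d B)"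
proof -
  define K where "K = {lam. c lam \<noteq> 0}"
  note K = e_expansion_support[OF assms(1) K_def]
  define L where "L = {lam. d lam \<noteq> 0}"
  note L = e_expansion_support[OF assms(2) L_def]
  define s :: "nat multiset \<times> nat multiset \<Rightarrow> nat multiset" where "s = (\<lambda>(A, B). A + B)"
  let ?Q = "s ` (K \<times> L)"
  have "F * G = (\<Sum>A\<in>K. \<Sum>B\<in>L. (c A * d B) *\<^sub>s e_basis (A + B))"
    unfolding K(4) L(4) by (simp add: sum_product smult_series_mult e_basis_plus)
  also have "\<dots> = (\<Sum>p\<in>K \<times> L. (c (fst p) * d (snd p)) *\<^sub>s e_basis (s p))"
    by (simp add: sum.cartesian_product s_def case_prod_unfold)
  also have "\<dots> = (\<Sum>lam\<in>?Q. \<Sum>p\<in>{p \<in> K \<times> L. s p = lam}.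
      (c (fst p) * d (snd p)) *\<^sub>s e_basis (s p))"
    by (rule sum.group[symmetric]) (use K L in auto)
  also have "\<dots> = (\<Sum>lam\<in>?Q. (\<Sum>(A, B) | A + B = lam. c A * d B) *\<^sub>s e_basis lam)"
  proof (rule sum.cong[OF refl])
    fix lam
    have "(\<Sum>(A, B) | A + B = lam. c A * d B) = (\<Sum>p\<in>{p \<in> K \<times> L. s p = lam}. c (fst p) * d (snd p))"
      unfolding case_prod_unfold
      by (rule sum.mono_neutral_right) (use K L in \<open>auto simp: finite_msplits[unfolded case_prod_unfold] s_def\<close>)
    then show "(\<Sum>p\<in>{p \<in> K \<times> L. s p = lam}. (c (fst p) * d (snd p)) *\<^sub>s e_basis (s p))
        = (\<Sum>(A, B) | A + B = lam. c A * d B) *\<^sub>s e_basis lam"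
      by (simp add: smult_series_sum_left)
  qed
  finally have FG: "F * G = (\<Sum>lam\<in>?Q. (\<Sum>(A, B) | A + B = lam. c A * d B) *\<^sub>s e_basis lam)" .
  show ?thesis
  proof (rule e_expansionI[OF _ _ _ FG])
    show "lam \<in> ?Q" if nz: "(\<Sum>(A, B) | A + B = lam. c A * d B) \<noteq> 0" for lam
    proof -
      obtain p where "p \<in> {(A, B). A + B = lam}" "(case p of (A, B) \<Rightarrow> c A * d B) \<noteq> 0"
        using nz by (meson sum.neutral)
      then show ?thesis using K(3) L(3) by (force simp: s_def)
    qed
  qed (use K L in \<open>auto simp: s_def is_partition_def\<close>)
qed

text \<open>The difference of two expansions expands 0, to which linear independence applies.
  Uniqueness is what lets the description in \<open>e_coeff\<close> denote.\<close>

lemma e_expansion_unique: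
  assumes "e_expansion F c" "e_expansion F d"
  shows "c = d"
proof
  fix mu
  have "e_expansion (F + (-1) *\<^sub>s F) (\<lambda>lam. c lam + (-1) * d lam)"
    by (intro e_expansion_add e_expansion_smult assms)
  moreover have "F + (-1) *\<^sub>s F = 0"
    by (rule series_eqI) (simp add: plus_series.rep_eq smult_series.rep_eq zero_series.rep_eq)
  ultimately have "e_expansion 0 (\<lambda>lam. c lam - d lam)" by simp
  note K = e_expansion_support[OF this refl]
  have "c mu - d mu = 0" if "c mu - d mu \<noteq> 0"
    by (rule e_basis_independent[OF K(1) K(2) K(4)[symmetric]]) (use that in simp_all)
  then show "c mu = d mu" by auto
qed

lemma e_coeff_eq: "e_expansion F c \<Longrightarrow> e_coeff lam F = c lam"
  unfolding e_coeff_def using e_expansion_unique by (metis the_equality)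

text \<open>The working substitute for being symmetric of bounded degree. For chromatic symmetric
  functions it will follow from their power sum expansion.\<close>

definition e_expandable :: "series \<Rightarrow> bool" where
  "e_expandable F \<longleftrightarrow> (\<exists>c. e_expansion F c)"

lemma e_expansion_e_coeff: "e_expandable F \<Longrightarrow> e_expansion F (\<lambda>lam. e_coeff lam F)"
  unfolding e_expandable_def using e_coeff_eq by (metis ext)

lemma
  assumes "e_expandable F" "e_expandable G"
  shows e_expandable_add: "e_expandable (F + G)"
    and e_coeff_add: "e_coeff lam (F + G) = e_coeff lam F + e_coeff lam G"
    and e_expandable_mult: "e_expandable (F * G)"
    and e_coeff_mult: "e_coeff lam (F * G) = (\<Sum>(A, B) | A + B = lam. e_coeff A F * e_coeff B G)"
  using e_expansion_add[OF assms[THEN e_expansion_e_coeff]] e_expansion_mult[OF assms[THEN e_expansion_e_coeff]]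
  by (auto simp: e_expandable_def e_coeff_eq)

lemma
  assumes "e_expandable F"
  shows e_expandable_smult: "e_expandable (a *\<^sub>s F)"
    and e_coeff_smult: "e_coeff lam (a *\<^sub>s F) = a * e_coeff lam F"
  using e_expansion_smult[OF assms[THEN e_expansion_e_coeff], of a]
  by (auto simp: e_expandable_def e_coeff_eq)

lemma
  assumes "e_expandable F" "e_expandable G"
  shows e_expandable_diff: "e_expandable (F - G)"
    and e_coeff_diff: "e_coeff lam (F - G) = e_coeff lam F - e_coeff lam G"
proof -
  have "F - G = F + (-1) *\<^sub>s G"
    by (rule series_eqI) (simp add: minus_series.rep_eq plus_series.rep_eq smult_series.rep_eq)
  then show "e_expandable (F - G)" "e_coeff lam (F - G) = e_coeff lam F - e_coeff lam G"
    unfolding \<open>F - G = F + (-1) *\<^sub>s G\<close> using assms e_expandable_smult[OF assms(2)]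
    by (simp_all add: e_expandable_add e_coeff_add e_coeff_smult)
qed

lemma
  assumes "\<And>x. x \<in> A \<Longrightarrow> e_expandable (f x)"
  shows e_expandable_sum: "e_expandable (sum f A)"
    and e_coeff_sum: "e_coeff lam (sum f A) = (\<Sum>x\<in>A. e_coeff lam (f x))"
proof -
  have "e_expandable (sum f A) \<and> e_coeff lam (sum f A) = (\<Sum>x\<in>A. e_coeff lam (f x))"
    using assms
  proof (induction A rule: infinite_finite_induct)
    case (insert x A)
    then show ?case by (simp add: e_expandable_add e_coeff_add)
  qed (use e_expansion_zero in \<open>auto simp: e_expandable_def e_coeff_eq[OF e_expansion_zero]\<close>)
  then show "e_expandable (sum f A)" "e_coeff lam (sum f A) = (\<Sum>x\<in>A. e_coeff lam (f x))"
    by auto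
qed

section \<open>Generating series of weighted sets\<close>

text \<open>Turns identities between series into bijections between weighted sets. A monomial with
  an infinite fibre gets coefficient 0, the default value of \<open>card\<close>; hence the
  finiteness assumptions in the rules for unions and products.\<close>

definition gen_series :: "'b set \<Rightarrow> ('b \<Rightarrow> nat multiset) \<Rightarrow> series" where
  "gen_series A f = Abs_series (\<lambda>M. of_nat (card {a \<in> A. f a = M}))"

lemma mcoeff_gen_series: "mcoeff (gen_series A f) M = of_nat (card {a \<in> A. f a = M})"
  by (simp add: gen_series_def Abs_series_inverse)

lemma gen_series_reindex:
  assumes "bij_betw h A B" "\<And>a. a \<in> A \<Longrightarrow> g (h a) = f a"
  shows "gen_series A f = gen_series B g"
proof (rule series_eqI)
  fix M
  have "bij_betw h {a \<in> A. f a = M} {b \<in> B. g b = M}"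
    using assms unfolding bij_betw_def by (auto intro: inj_on_subset)
  then show "mcoeff (gen_series A f) M = mcoeff (gen_series B g) M"
    by (simp add: mcoeff_gen_series bij_betw_same_card)
qed

lemma gen_series_Un:
  assumes "A \<inter> B = {}" "\<And>M. finite {a \<in> A \<union> B. f a = M}"
  shows "gen_series (A \<union> B) f = gen_series A f + gen_series B f"
proof (rule series_eqI)
  fix M
  have eq: "{a \<in> A \<union> B. f a = M} = {a \<in> A. f a = M} \<union> {a \<in> B. f a = M}" by auto
  have "finite ({a \<in> A. f a = M} \<union> {a \<in> B. f a = M})" using assms(2)[of M] eq by simp
  then have "card {a \<in> A \<union> B. f a = M} = card {a \<in> A. f a = M} + card {a \<in> B. f a = M}"
    unfolding eq using assms(1) by (intro card_Un_disjoint) auto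
  then show "mcoeff (gen_series (A \<union> B) f) M = mcoeff (gen_series A f + gen_series B f) M"
    by (simp add: mcoeff_gen_series plus_series.rep_eq)
qed

lemma gen_series_times_fibre:
  fixes f :: "'a \<Rightarrow> 'm multiset" and g :: "'b \<Rightarrow> 'm multiset"
  assumes "\<And>M. finite {a \<in> A. f a = M}" "\<And>M. finite {b \<in> B. g b = M}"
  shows "finite {p \<in> A \<times> B. f (fst p) + g (snd p) = M}"
    and "card {p \<in> A \<times> B. f (fst p) + g (snd p) = M} =
      (\<Sum>(X, Y) | X + Y = M. card {a \<in> A. f a = X} * card {b \<in> B. g b = Y})"
proof -
  have eq: "{p \<in> A \<times> B. f (fst p) + g (snd p) = M} =
      (\<Union>q\<in>{(X, Y). X + Y = M}. {a \<in> A. f a = fst q} \<times> {b \<in> B. g b = snd q})"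
    by auto
  show "finite {p \<in> A \<times> B. f (fst p) + g (snd p) = M}"
    unfolding eq by (rule finite_UN_I[OF finite_msplits]) (use assms in auto)
  have "card {p \<in> A \<times> B. f (fst p) + g (snd p) = M} =
      (\<Sum>q\<in>{(X, Y). X + Y = M}. card ({a \<in> A. f a = fst q} \<times> {b \<in> B. g b = snd q}))"
    unfolding eq by (rule card_UN_disjoint[OF finite_msplits]) (use assms in auto)
  then show "card {p \<in> A \<times> B. f (fst p) + g (snd p) = M} =
      (\<Sum>(X, Y) | X + Y = M. card {a \<in> A. f a = X} * card {b \<in> B. g b = Y})"
    by (simp add: card_cartesian_product case_prod_unfold)
qed

lemma gen_series_times:
  assumes "\<And>M. finite {a \<in> A. f a = M}" "\<And>M. finite {b \<in> B. g b = M}"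
  shows "gen_series A f * gen_series B g = gen_series (A \<times> B) (\<lambda>p. f (fst p) + g (snd p))"
  by (rule series_eqI)
     (simp add: times_series.rep_eq mcoeff_gen_series gen_series_times_fibre(2)[OF assms]
        case_prod_unfold)

section \<open>Power sums\<close>

definition index_sets :: "nat \<Rightarrow> nat set set" where
  "index_sets k = {S. S \<subseteq> {1..} \<and> finite S \<and> card S = k}"

text \<open>On finite sets \<open>set_mset\<close> inverts \<open>mset_set\<close>, so a fibre has
  at most one element. This matches the 0/1 coefficients of \<open>elem_sym\<close>.\<close>

lemma index_sets_fibre:
  "{S \<in> index_sets k. mset_set S = M} =
    (if set_mset M \<in> index_sets k \<and> mset_set (set_mset M) = M then {set_mset M} else {})"
proof -
  have *: "S = set_mset M" if "S \<in> index_sets k" "mset_set S = M" for S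
    using that by (auto simp: index_sets_def)
  show ?thesis
  proof (cases "set_mset M \<in> index_sets k \<and> mset_set (set_mset M) = M")
    case True
    then have "{S \<in> index_sets k. mset_set S = M} = {set_mset M}" using * by blast
    with True show ?thesis by presburger
  next
    case False
    have "{S \<in> index_sets k. mset_set S = M} = {}"
    proof (rule equals0I)
      fix S assume S: "S \<in> {S \<in> index_sets k. mset_set S = M}"
      then have "S \<in> index_sets k" "mset_set S = M" by auto
      with *[OF this] False show False by metis
    qed
    with False show ?thesis by presburger
  qed
qed

lemma finite_index_sets_fibre: "finite {S \<in> index_sets k. mset_set S = M}"
  by (subst index_sets_fibre) simp

lemma elem_sym_eq_gen_series: "elem_sym k = gen_series (index_sets k) mset_set"
proof (rule series_eqI)
  fix M
  have "(\<exists>S\<subseteq>{1..}. finite S \<and> card S = k \<and> M = mset_set S) \<longleftrightarrow>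
      set_mset M \<in> index_sets k \<and> mset_set (set_mset M) = M"
    by (auto simp: index_sets_def)
  then show "mcoeff (elem_sym k) M = mcoeff (gen_series (index_sets k) mset_set) M"
    unfolding elem_sym.rep_eq mcoeff_gen_series index_sets_fibre by (simp only:) simp
qed

definition power_sum :: "nat \<Rightarrow> series" where
  "power_sum k = gen_series {1..} (replicate_mset k)"

lemma finite_replicate_fibre:
  assumes "k \<ge> 1"
  shows "finite {x \<in> {1..}. replicate_mset k x = M}"
proof (rule finite_subset)
  show "{x \<in> {1..}. replicate_mset k x = M} \<subseteq> set_mset M" using assms by auto
qed simp

text \<open>The sum of the monomials \<open>x\<^sub>S x\<^sub>a\<^sup>j\<close> over sets \<open>S\<close> of \<open>i\<close> positive indices and indices \<open>a \<notin> S\<close>;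
  up to sign these are the partial sums in Newton's identities.\<close>

definition hook :: "nat \<Rightarrow> nat \<Rightarrow> series" where
  "hook i j = gen_series {(S, x). S \<in> index_sets i \<and> x \<ge> 1 \<and> x \<notin> S}
     (\<lambda>p. mset_set (fst p) + replicate_mset j (snd p))"

lemma hook_0: "hook 0 j = power_sum j"
  unfolding hook_def power_sum_def
  by (rule gen_series_reindex[symmetric, of "\<lambda>x. ({}, x)"])
     (auto simp: bij_betw_def inj_on_def index_sets_def)

lemma insert_index_sets: "\<lbrakk>S \<in> index_sets i; x \<ge> 1; x \<notin> S\<rbrakk> \<Longrightarrow> insert x S \<in> index_sets (Suc i)"
  by (auto simp: index_sets_def)

lemma remove_index_sets: "\<lbrakk>S \<in> index_sets (Suc i); x \<in> S\<rbrakk> \<Longrightarrow> S - {x} \<in> index_sets i"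
  by (auto simp: index_sets_def)

text \<open>A pair \<open>(S, x)\<close> amounts to the set \<open>insert x S\<close> with a marked
  element, and a set of size \<open>Suc i\<close> can be marked in \<open>Suc i\<close>
  ways.\<close>

lemma hook_1: "hook i 1 = of_nat (Suc i) *\<^sub>s elem_sym (Suc i)"
proof -
  let ?B = "Sigma (index_sets (Suc i)) id"
  have "hook i 1 = gen_series ?B (\<lambda>p. mset_set (fst p))"
    unfolding hook_def
  proof (rule gen_series_reindex)
    show "bij_betw (\<lambda>(S, x). (insert x S, x)) {(S, x). S \<in> index_sets i \<and> x \<ge> 1 \<and> x \<notin> S} ?B"
    proof (rule bij_betw_byWitness[where f' = "\<lambda>(S, x). (S - {x}, x)"])
      show "(\<lambda>(S, x). (S - {x}, x)) ` ?B \<subseteq> {(S, x). S \<in> index_sets i \<and> x \<ge> 1 \<and> x \<notin> S}"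
        using remove_index_sets by (auto simp: index_sets_def)
    qed (auto intro: insert_index_sets)
  qed (auto simp: index_sets_def)
  also have "\<dots> = of_nat (Suc i) *\<^sub>s elem_sym (Suc i)"
  proof (rule series_eqI)
    fix M
    have "{p \<in> ?B. mset_set (fst p) = M} =
        Sigma {S \<in> index_sets (Suc i). mset_set S = M} id" by auto
    also have "card \<dots> = Suc i * card {S \<in> index_sets (Suc i). mset_set S = M}"
    proof -
      let ?F = "{S \<in> index_sets (Suc i). mset_set S = M}"
      have "card (Sigma ?F id) = (\<Sum>S\<in>?F. card S)"
        using finite_index_sets_fibre[of "Suc i" M] by (subst card_SigmaI) (auto simp: index_sets_def)
      also have "\<dots> = (\<Sum>S\<in>?F. Suc i)"
        by (rule sum.cong) (auto simp: index_sets_def)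
      finally show ?thesis by simp
    qed
    finally show "mcoeff (gen_series ?B (\<lambda>p. mset_set (fst p))) M =
        mcoeff (of_nat (Suc i) *\<^sub>s elem_sym (Suc i)) M"
      by (simp add: mcoeff_gen_series smult_series.rep_eq elem_sym_eq_gen_series algebra_simps)
  qed
  finally show ?thesis .
qed

text \<open>Split by whether the index \<open>x\<close> of the power lies in the set
  \<open>S\<close>. If it does, remove it from \<open>S\<close> and raise the exponent by
  one.\<close>

lemma elem_sym_times_power_sum:
  assumes "j \<ge> 1"
  shows "elem_sym (Suc i) * power_sum j = hook (Suc i) j + hook i (Suc j)"
proof -
  let ?f = "\<lambda>p. mset_set (fst p) + replicate_mset j (snd p)"
  let ?N = "{(S, x). S \<in> index_sets (Suc i) \<and> x \<ge> 1 \<and> x \<notin> S}"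
  let ?M = "{(S, x). S \<in> index_sets (Suc i) \<and> x \<ge> 1 \<and> x \<in> S}"
  have fin: "finite {p \<in> index_sets (Suc i) \<times> {1..}. ?f p = M}" for M
    by (rule gen_series_times_fibre(1)[OF finite_index_sets_fibre finite_replicate_fibre[OF assms]])
  have un: "index_sets (Suc i) \<times> {1..} = ?N \<union> ?M" by auto
  have "elem_sym (Suc i) * power_sum j = gen_series (index_sets (Suc i) \<times> {1..}) ?f"
    unfolding elem_sym_eq_gen_series power_sum_def
    by (rule gen_series_times[OF finite_index_sets_fibre finite_replicate_fibre[OF assms]])
  also have "\<dots> = gen_series ?N ?f + gen_series ?M ?f"
    unfolding un by (rule gen_series_Un) (use fin[unfolded un] in auto)
  also have "gen_series ?M ?f = hook i (Suc j)"
    unfolding hook_def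
  proof (rule gen_series_reindex)
    show "bij_betw (\<lambda>(S, x). (S - {x}, x)) ?M {(S, x). S \<in> index_sets i \<and> x \<ge> 1 \<and> x \<notin> S}"
    proof (rule bij_betw_byWitness[where f' = "\<lambda>(S, x). (insert x S, x)"])
      show "(\<lambda>(S, x). (insert x S, x)) ` {(S, x). S \<in> index_sets i \<and> x \<ge> 1 \<and> x \<notin> S} \<subseteq> ?M"
        using insert_index_sets by auto
    qed (auto intro: remove_index_sets)
  next
    fix p assume "p \<in> ?M"
    then obtain S x where p: "p = (S, x)" "finite S" "x \<in> S" by (auto simp: index_sets_def)
    then have "mset_set S = add_mset x (mset_set (S - {x}))"
      by (metis mset_set.remove)
    then show "mset_set (fst (case p of (S, x) \<Rightarrow> (S - {x}, x))) +
        replicate_mset (Suc j) (snd (case p of (S, x) \<Rightarrow> (S - {x}, x))) = ?f p"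
      using p by simp
  qed
  finally show ?thesis by (simp add: hook_def)
qed

section \<open>Degree and number of parts\<close>

text \<open>Here \<open>d\<close> is the degree and \<open>m\<close> a lower bound on the number of
  parts. The bound makes a product of many factors invisible to coefficients indexed by short
  partitions.\<close>

definition e_graded :: "nat \<Rightarrow> nat \<Rightarrow> series \<Rightarrow> bool" where
  "e_graded m d F \<longleftrightarrow> e_expandable F \<and>
     (\<forall>lam. e_coeff lam F \<noteq> 0 \<longrightarrow> m \<le> size lam \<and> \<Sum>\<^sub># lam = d)"

lemma e_graded_expandable: "e_graded m d F \<Longrightarrow> e_expandable F"
  by (simp add: e_graded_def)

lemma e_graded_mono: "e_graded m d F \<Longrightarrow> m' \<le> m \<Longrightarrow> e_graded m' d F"
  unfolding e_graded_def by (meson le_trans)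

lemma e_graded_smult: "e_graded m d F \<Longrightarrow> e_graded m d (a *\<^sub>s F)"
  unfolding e_graded_def by (simp add: e_expandable_smult e_coeff_smult)

lemma e_graded_diff:
  assumes "e_graded m d F" "e_graded m d G"
  shows "e_graded m d (F - G)"
proof -
  have "m \<le> size lam \<and> \<Sum>\<^sub># lam = d" if "e_coeff lam F - e_coeff lam G \<noteq> 0" for lam
    using that assms unfolding e_graded_def by (cases "e_coeff lam F = 0") auto
  then show ?thesis using assms unfolding e_graded_def by (simp add: e_expandable_diff e_coeff_diff)
qed

lemma e_graded_mult:
  assumes "e_graded m d F" "e_graded m' d' G"
  shows "e_graded (m + m') (d + d') (F * G)"
proof -
  have F: "e_expandable F" and G: "e_expandable G" using assms by (auto simp: e_graded_def)
  have "m + m' \<le> size lam \<and> \<Sum>\<^sub># lam = d + d'" if nz: "e_coeff lam (F * G) \<noteq> 0" for lam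
  proof -
    obtain p where "p \<in> {(A, B). A + B = lam}"
      "(case p of (A, B) \<Rightarrow> e_coeff A F * e_coeff B G) \<noteq> 0"
      using nz unfolding e_coeff_mult[OF F G] by (meson sum.neutral)
    then obtain A B where AB: "lam = A + B" "e_coeff A F \<noteq> 0" "e_coeff B G \<noteq> 0" by auto
    have "m \<le> size A \<and> \<Sum>\<^sub># A = d" "m' \<le> size B \<and> \<Sum>\<^sub># B = d'"
      using assms AB(2,3) by (auto simp: e_graded_def)
    then show ?thesis using AB(1) by simp
  qed
  then show ?thesis using F G by (simp add: e_graded_def e_expandable_mult)
qed

lemma e_graded_one: "e_graded 0 0 1"
  using e_coeff_eq[OF e_expansion_one] e_expansion_one by (auto simp: e_graded_def e_expandable_def)

lemma e_graded_elem_sym: "k \<ge> 1 \<Longrightarrow> e_graded 1 k (elem_sym k)"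
  using e_coeff_eq[OF e_expansion_elem_sym] e_expansion_elem_sym
  by (auto simp: e_graded_def e_expandable_def)

lemma e_graded_prod:
  assumes "\<And>x. x \<in> A \<Longrightarrow> e_graded 1 (d x) (f x)"
  shows "finite A \<Longrightarrow> e_graded (card A) (sum d A) (prod f A)"
  using assms
proof (induction A rule: infinite_finite_induct)
  case (insert x A)
  then show ?case using e_graded_mult[of 1 "d x" "f x" "card A" "sum d A" "prod f A"] by simp
qed (auto simp: e_graded_one)

text \<open>Newton's identities: the product in \<open>elem_sym_times_power_sum\<close> only
  involves partitions with at least two parts, so passing from \<open>hook (Suc i) j\<close> to
  \<open>hook i (Suc j)\<close> just flips the sign of the single-part coefficient. The induction
  keeps \<open>i\<close> arbitrary because it is used at \<open>Suc i\<close> and at 0, where the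
  hook is a power sum.\<close>

lemma e_coeff_hook:
  assumes "j \<ge> 1"
  shows "e_graded 1 (i + j) (hook i j) \<and> e_coeff {#i + j#} (hook i j) = (-1) ^ (j - 1) * of_nat (i + j)"
  using assms
proof (induction j arbitrary: i rule: dec_induct)
  case base
  have "e_graded 1 (Suc i) (hook i 1)"
    unfolding hook_1 by (intro e_graded_smult e_graded_elem_sym) simp
  moreover have "e_expandable (elem_sym (Suc i))"
    using e_graded_elem_sym[of "Suc i"] by (auto simp: e_graded_def)
  then have "e_coeff {#Suc i#} (hook i 1) = of_nat (Suc i)"
    unfolding hook_1 using e_coeff_eq[OF e_expansion_elem_sym[of "Suc i"]] by (simp add: e_coeff_smult)
  ultimately show ?case by simp
next
  case (step j)
  have eq: "hook i (Suc j) = elem_sym (Suc i) * power_sum j - hook (Suc i) j"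
    using elem_sym_times_power_sum[OF step(1), of i] by simp
  have p: "e_graded (1 + 1) (Suc i + (0 + j)) (elem_sym (Suc i) * power_sum j)"
    by (rule e_graded_mult) (use e_graded_elem_sym[of "Suc i"] step.IH[of 0] in \<open>simp_all add: hook_0\<close>)
  have h: "e_graded 1 (Suc i + j) (hook (Suc i) j)"
    "e_coeff {#Suc i + j#} (hook (Suc i) j) = (-1) ^ (j - 1) * of_nat (Suc i + j)"
    using step.IH[of "Suc i"] by auto
  have g: "e_graded 1 (i + Suc j) (hook i (Suc j))"
    unfolding eq using e_graded_diff[OF e_graded_mono[OF p, of 1] ] h(1) by simp
  have z: "e_coeff {#Suc i + j#} (elem_sym (Suc i) * power_sum j) = 0"
    using p by (auto simp: e_graded_def)
  have "e_coeff {#i + Suc j#} (hook i (Suc j)) = - ((-1) ^ (j - 1) * of_nat (Suc i + j))"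
    unfolding eq using z h p by (simp add: e_coeff_diff e_graded_expandable)
  also have "\<dots> = (-1) ^ (Suc j - 1) * of_nat (i + Suc j)"
    using step(1) by (cases j) auto
  finally show ?case using g by blast
qed

lemma
  assumes "k \<ge> 1"
  shows e_graded_power_sum: "e_graded 1 k (power_sum k)"
    and e_coeff_power_sum: "e_coeff {#k#} (power_sum k) = (-1) ^ (k - 1) * of_nat k"
  using e_coeff_hook[OF assms, of 0] by (simp_all add: hook_0)

section \<open>Alternating sums over spanning subgraphs\<close>

text \<open>The partition of \<open>V\<close> into the components of the edge set \<open>S\<close>,
  as an equivalence relation. An edge may be given by one arc only, hence the converse; the
  intersection discards the reflexive pairs outside \<open>V\<close>.\<close>

definition eq_closure :: "'a set \<Rightarrow> 'a rel \<Rightarrow> 'a rel" where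
  "eq_closure V S = (S \<union> S\<inverse>)\<^sup>* \<inter> V \<times> V"

lemma equiv_eq_closure: "equiv V (eq_closure V S)"
proof (rule equivI)
  show "sym (eq_closure V S)"
    unfolding eq_closure_def by (intro sym_Int sym_rtrancl sym_Un_converse) (auto simp: sym_def)
  show "trans (eq_closure V S)"
    unfolding eq_closure_def by (intro trans_Int trans_rtrancl) (auto simp: trans_def)
qed (auto simp: eq_closure_def refl_on_def)

lemma subset_eq_closure: "S \<subseteq> V \<times> V \<Longrightarrow> S \<subseteq> eq_closure V S"
  by (auto simp: eq_closure_def)

lemma eq_closure_least:
  assumes "equiv V P" "S \<subseteq> P"
  shows "eq_closure V S \<subseteq> P"
proof clarify
  fix x y assume xy: "(x, y) \<in> eq_closure V S"
  then have "(x, y) \<in> (S \<union> S\<inverse>)\<^sup>*" "x \<in> V" by (auto simp: eq_closure_def)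
  then show "(x, y) \<in> P"
  proof (induction rule: rtrancl_induct)
    case base
    then show ?case using assms(1) by (auto simp: equiv_def refl_on_def)
  next
    case (step y z)
    have "sym P" "trans P" using assms(1) by (auto simp: equiv_def)
    then have "(y, z) \<in> P" using step(2) assms(2) by (auto dest: symD)
    then show ?case using step \<open>trans P\<close> by (meson transD)
  qed
qed

lemma eq_closure_mono: "S \<subseteq> T \<Longrightarrow> T \<subseteq> V \<times> V \<Longrightarrow> eq_closure V S \<subseteq> eq_closure V T"
  by (rule eq_closure_least[OF equiv_eq_closure]) (use subset_eq_closure[of T V] in blast)

lemma eq_closure_absorb:
  assumes "S \<subseteq> eq_closure V T" "T \<subseteq> S" "S \<subseteq> V \<times> V"
  shows "eq_closure V S = eq_closure V T"
  by (intro equalityI eq_closure_least[OF equiv_eq_closure] eq_closure_mono) (use assms in auto)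

lemma eq_closure_subset: "eq_closure V S \<subseteq> V \<times> V"
  by (auto simp: eq_closure_def)

text \<open>The effect of a new edge on the components: the classes of \<open>u\<close> and
  \<open>v\<close> are united.\<close>

definition merge :: "'a rel \<Rightarrow> 'a \<Rightarrow> 'a \<Rightarrow> 'a rel" where
  "merge R u v = R \<union> (R `` {u, v}) \<times> (R `` {u, v})"

text \<open>With \<open>W\<close> the union of the classes of \<open>u\<close> and \<open>v\<close>,
  the classes outside \<open>W\<close> (collected in \<open>Q\<close>) stay the same. Two classes on
  one side therefore face the single class \<open>W\<close> on the other.\<close>

lemma
  assumes R: "equiv V R" and uv: "u \<in> V" "v \<in> V"
  shows equiv_merge: "equiv V (merge R u v)"
    and card_quotient_merge: "\<lbrakk>finite V; (u, v) \<notin> R\<rbrakk> \<Longrightarrow> card (V // R) = Suc (card (V // merge R u v))"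
proof -
  define W where "W = R `` {u, v}"
  have sub: "R \<subseteq> V \<times> V" using R by (rule equiv_type)
  have refl: "(x, x) \<in> R" if "x \<in> V" for x
    using R that by (meson equiv_def refl_onD)
  have symR: "(y, x) \<in> R" if "(x, y) \<in> R" for x y
    using R that by (meson equiv_def symD)
  have transR: "(x, z) \<in> R" if "(x, y) \<in> R" "(y, z) \<in> R" for x y z
    using R that by (meson equiv_def transD)
  have W: "\<And>x y. (x, y) \<in> R \<Longrightarrow> x \<in> W \<longleftrightarrow> y \<in> W" "W \<subseteq> V" "u \<in> W" "v \<in> W"
  proof -
    have mem: "x \<in> W \<longleftrightarrow> (u, x) \<in> R \<or> (v, x) \<in> R" for x by (auto simp: W_def)
    show "x \<in> W \<longleftrightarrow> y \<in> W" if "(x, y) \<in> R" for x y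
      using that symR transR unfolding mem by metis
    show "W \<subseteq> V" using sub by (auto simp: mem)
    show "u \<in> W" "v \<in> W" using refl uv by (auto simp: mem)
  qed
  have m: "merge R u v = R \<union> W \<times> W" by (simp add: merge_def W_def)
  show "equiv V (merge R u v)"
  proof (rule equivI)
    show "sym (merge R u v)" using symR by (intro symI) (auto simp: m)
    show "trans (merge R u v)" using transR W(1) by (intro transI) (auto simp: m)
  qed (use sub refl W(2) in \<open>auto simp: m refl_on_def\<close>)
  assume "finite V" "(u, v) \<notin> R"
  define Q where "Q = (\<lambda>x. R `` {x}) ` (V - W)"
  have ne: "R `` {u} \<noteq> R `` {v}" using \<open>(u, v) \<notin> R\<close> refl uv by blast
  have inW: "R `` {x} = R `` {u} \<or> R `` {x} = R `` {v}" if "x \<in> W" for x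
  proof -
    have "(u, x) \<in> R \<or> (v, x) \<in> R" using that by (auto simp: W_def)
    then show ?thesis using equiv_class_eq[OF R] by metis
  qed
  have "V // R = (\<lambda>x. R `` {x}) ` V" by (auto simp: quotient_def)
  also have "\<dots> = Q \<union> (\<lambda>x. R `` {x}) ` W" using W(2) by (auto simp: Q_def)
  also have "(\<lambda>x. R `` {x}) ` W = {R `` {u}, R `` {v}}"
    using inW W(3,4) by auto
  finally have q1: "V // R = Q \<union> {R `` {u}, R `` {v}}" .
  have "V // merge R u v = (\<lambda>x. merge R u v `` {x}) ` V" by (auto simp: quotient_def)
  also have "\<dots> = (\<lambda>x. merge R u v `` {x}) ` (V - W) \<union> (\<lambda>x. merge R u v `` {x}) ` W"
    using W(2) by auto
  also have "(\<lambda>x. merge R u v `` {x}) ` (V - W) = Q"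
    unfolding Q_def m by (rule image_cong) auto
  also have "(\<lambda>x. merge R u v `` {x}) ` W = {W}"
  proof -
    have "merge R u v `` {x} = W" if "x \<in> W" for x
      using that W(1) by (auto simp: m)
    then show ?thesis using W(3) by auto
  qed
  finally have q2: "V // merge R u v = Q \<union> {W}" .
  have dis: "W \<notin> Q" "R `` {u} \<notin> Q" "R `` {v} \<notin> Q"
  proof -
    have *: "\<exists>x\<in>C. x \<notin> W" if "C \<in> Q" for C using that refl unfolding Q_def by blast
    have "R `` {u} \<subseteq> W" "R `` {v} \<subseteq> W" by (auto simp: W_def)
    then show "W \<notin> Q" "R `` {u} \<notin> Q" "R `` {v} \<notin> Q" using * by blast+
  qed
  have "finite Q" using \<open>finite V\<close> by (simp add: Q_def)
  then show "card (V // R) = Suc (card (V // merge R u v))"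
    unfolding q1 q2 using dis ne by simp
qed

lemma eq_closure_insert:
  assumes "T \<subseteq> V \<times> V" "u \<in> V" "v \<in> V"
  shows "eq_closure V (insert (u, v) T) = merge (eq_closure V T) u v"
proof
  let ?R = "eq_closure V T" and ?S = "eq_closure V (insert (u, v) T)"
  have R: "equiv V ?R" and S: "equiv V ?S" by (rule equiv_eq_closure)+
  have "insert (u, v) T \<subseteq> merge ?R u v"
    using subset_eq_closure[OF assms(1)] assms(2,3) R
    by (auto simp: merge_def equiv_def refl_on_def)
  then show "?S \<subseteq> merge ?R u v"
    using eq_closure_least[OF equiv_merge[OF R assms(2,3)]] by blast
  have sub: "?R \<subseteq> ?S" by (rule eq_closure_mono) (use assms in auto)
  have uv: "(u, v) \<in> ?S" using subset_eq_closure[of "insert (u, v) T" V] assms by auto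
  have "sym ?S" "trans ?S" using S by (auto simp: equiv_def)
  have "(u, x) \<in> ?S" if "x \<in> ?R `` {u, v}" for x
    using that sub uv \<open>trans ?S\<close> by (blast dest: transD)
  then have "?R `` {u, v} \<times> ?R `` {u, v} \<subseteq> ?S"
    using \<open>sym ?S\<close> \<open>trans ?S\<close> by (blast dest: transD symD)
  then show "merge ?R u v \<subseteq> ?S" using sub by (simp add: merge_def)
qed

text \<open>The exchange property of the graphic matroid: if \<open>f\<close> becomes redundant only
  through \<open>e\<close>, then \<open>f\<close> runs between the same two classes of
  \<open>T\<close> as \<open>e\<close>.\<close>

lemma eq_closure_exchange:
  assumes "insert e T \<subseteq> V \<times> V" "f \<in> eq_closure V (insert e T)" "f \<notin> eq_closure V T"
  shows "e \<in> eq_closure V (insert f T)"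
proof -
  obtain u v x y where [simp]: "e = (u, v)" "f = (x, y)" by (cases e, cases f) auto
  have T: "T \<subseteq> V \<times> V" and uv: "u \<in> V" "v \<in> V" and xy: "x \<in> V" "y \<in> V"
    using assms(1,2) eq_closure_subset[of V "insert e T"] by auto
  let ?R = "eq_closure V T"
  have "sym ?R" "trans ?R" using equiv_eq_closure[of V T] by (auto simp: equiv_def)
  have "x \<in> ?R `` {u, v}" "y \<in> ?R `` {u, v}"
    using assms(2,3) eq_closure_insert[OF T uv] by (auto simp: merge_def)
  moreover have "(x, y) \<notin> ?R" using assms(3) by simp
  ultimately have "u \<in> ?R `` {x, y}" "v \<in> ?R `` {x, y}"
    using \<open>sym ?R\<close> \<open>trans ?R\<close> by (blast dest: transD symD)+
  then show ?thesis using eq_closure_insert[OF T xy] by (simp add: merge_def)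
qed

section \<open>Deletion-contraction\<close>

text \<open>The edges in \<open>T\<close> are forced into every subgraph and do not count in the
  sign. With \<open>T = {}\<close> this is the shape of the power sum expansion after a functional
  is applied to it.\<close>

definition alt_sum :: "('a rel \<Rightarrow> rat) \<Rightarrow> 'a set \<Rightarrow> 'a rel \<Rightarrow> 'a rel \<Rightarrow> rat" where
  "alt_sum F V T E = (\<Sum>S\<in>Pow E. (-1) ^ card S * F (eq_closure V (T \<union> S)))"

text \<open>Separate the subsets that avoid \<open>e\<close> from those that contain it; the latter
  lose one element from the sign, hence the minus.\<close>

lemma alt_sum_insert:
  assumes "finite E" "e \<notin> E"
  shows "alt_sum F V T (insert e E) = alt_sum F V T E - alt_sum F V (insert e T) E"
proof -
  have "alt_sum F V T (insert e E) = alt_sum F V T E +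
      (\<Sum>S\<in>insert e ` Pow E. (-1) ^ card S * F (eq_closure V (T \<union> S)))"
    unfolding alt_sum_def Pow_insert by (rule sum.union_disjoint) (use assms in auto)
  also have "(\<Sum>S\<in>insert e ` Pow E. (-1) ^ card S * F (eq_closure V (T \<union> S))) =
      (\<Sum>S\<in>Pow E. (-1) ^ card (insert e S) * F (eq_closure V (T \<union> insert e S)))"
    by (rule sum.reindex_cong[of "insert e"]) (use assms in \<open>auto simp: inj_on_def\<close>)
  also have "\<dots> = (\<Sum>S\<in>Pow E. - ((-1) ^ card S * F (eq_closure V (insert e T \<union> S))))"
  proof (rule sum.cong[OF refl])
    fix S assume "S \<in> Pow E"
    then have "finite S" "e \<notin> S" using assms finite_subset by auto
    then show "(-1) ^ card (insert e S) * F (eq_closure V (T \<union> insert e S)) =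
        - ((-1) ^ card S * F (eq_closure V (insert e T \<union> S)))" by simp
  qed
  finally show ?thesis by (simp add: alt_sum_def sum_negf)
qed

text \<open>Deletion-contraction, where contracting an edge moves it from \<open>E\<close> to \<open>T\<close>: contraction lowers the
  number of classes by one, so both terms of the recursion carry the same sign.  Positivity survives
  because either the hypothesis on \<open>P\<close> still holds after the deletion of \<open>e\<close>, or \<open>e\<close> is a bridge
  inside a class of \<open>P\<close> and its contraction creates no loop.\<close>

lemma alt_sum_sign:
  assumes "finite E" "finite V" "E \<subseteq> V \<times> V" "T \<subseteq> V \<times> V"
    and F: "\<And>P. 0 \<le> F P" "\<And>P. F P \<noteq> 0 \<Longrightarrow> card (V // P) = c"
  shows "0 \<le> (-1) ^ (card (V // eq_closure V T) + c) * alt_sum F V T E \<and>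
    (E \<inter> eq_closure V T = {} \<longrightarrow> (\<exists>P. equiv V P \<and> 0 < F P \<and> P = eq_closure V (T \<union> (E \<inter> P))) \<longrightarrow>
      0 < (-1) ^ (card (V // eq_closure V T) + c) * alt_sum F V T E)"
  using assms(1,3,4)
proof (induction E arbitrary: T rule: finite_induct)
  case empty
  \<comment> \<open>Only one term is left, and wherever \<open>F\<close> is nonzero the exponent is
    the even number \<open>2 * c\<close>.\<close>
  have 1: "(-1) ^ (card (V // P) + c) * F P = F P" for P
    using F(2)[of P] by (cases "F P = 0") (auto simp flip: mult_2)
  show ?case by (auto simp: alt_sum_def 1 F(1))
next
  case (insert e E)
  obtain u v where e: "e = (u, v)" by (cases e)
  let ?s = "\<lambda>T. (-1) ^ (card (V // eq_closure V T) + c) :: rat"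
  have T': "insert e T \<subseteq> V \<times> V" and E: "E \<subseteq> V \<times> V" and T: "T \<subseteq> V \<times> V"
    and uv: "u \<in> V" "v \<in> V"
    using insert.prems e by auto
  note IH1 = insert.IH[OF E T] and IH2 = insert.IH[OF E T']
  note rec = alt_sum_insert[OF insert.hyps(1,2), of F V T]
  show ?case
  proof (cases "e \<in> eq_closure V T")
    case True
    \<comment> \<open>Here \<open>e\<close> is a loop modulo \<open>T\<close>: deletion and
      contraction agree, so the alternating sum is 0, and the strict claim is vacuous.\<close>
    have "eq_closure V (insert e T \<union> S) = eq_closure V (T \<union> S)" if "S \<subseteq> E" for S
    proof (rule eq_closure_absorb)
      have "T \<union> S \<subseteq> V \<times> V" using that E T by blast
      then show "insert e T \<union> S \<subseteq> eq_closure V (T \<union> S)"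
        using True subset_eq_closure[of "T \<union> S" V] eq_closure_mono[of T "T \<union> S" V] by blast
    qed (use that E T' in auto)
    then have "alt_sum F V (insert e T) E = alt_sum F V T E"
      by (simp add: alt_sum_def)
    then show ?thesis using rec True by simp
  next
    case False
    have "card (V // eq_closure V T) = Suc (card (V // eq_closure V (insert e T)))"
      unfolding e eq_closure_insert[OF T uv]
      by (rule card_quotient_merge[OF equiv_eq_closure uv assms(2)]) (use False e in simp)
    then have s: "?s T = - ?s (insert e T)" by simp
    have rec': "?s T * alt_sum F V T (insert e E) =
        ?s T * alt_sum F V T E + ?s (insert e T) * alt_sum F V (insert e T) E"
      unfolding rec s by (simp add: algebra_simps)
    have "0 < ?s T * alt_sum F V T (insert e E)"
      if loops: "insert e E \<inter> eq_closure V T = {}" and P: "equiv V P" "0 < F P"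
        "P = eq_closure V (T \<union> (insert e E \<inter> P))" for P
    proof (cases "P = eq_closure V (T \<union> (E \<inter> P))")
      case True
      then have "0 < ?s T * alt_sum F V T E" using IH1 loops P(1,2) by blast
      then show ?thesis unfolding rec' using IH2 by linarith
    next
      case no: False
      then have "e \<in> P" using P(3) by (metis Int_insert_left)
      then have P3: "P = eq_closure V (insert e T \<union> (E \<inter> P))"
        using P(3) by (simp add: Int_insert_left)
      have sub: "T \<union> (E \<inter> P) \<subseteq> V \<times> V" using T E by auto
      \<comment> \<open>A loop \<open>f\<close> created by the contraction could be exchanged with
        \<open>e\<close>. As \<open>f\<close> lies in \<open>P\<close>, that would make
        \<open>e\<close> redundant inside \<open>P\<close>, against the case assumption.\<close>
      have "f \<notin> eq_closure V (insert e T)" if "f \<in> E" for f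
      proof
        assume f: "f \<in> eq_closure V (insert e T)"
        have "eq_closure V (insert e T) \<subseteq> P"
          by (subst P3, rule eq_closure_mono) (use sub T' in auto)
        then have "f \<in> P" using f by blast
        have "f \<notin> eq_closure V T" using loops that by blast
        then have "e \<in> eq_closure V (insert f T)" using eq_closure_exchange[OF T' f] by blast
        also have "\<dots> \<subseteq> eq_closure V (T \<union> (E \<inter> P))"
          by (rule eq_closure_mono) (use that \<open>f \<in> P\<close> sub in auto)
        finally have "e \<in> eq_closure V (T \<union> (E \<inter> P))" .
        then have "eq_closure V (insert e T \<union> (E \<inter> P)) = eq_closure V (T \<union> (E \<inter> P))"
          by (intro eq_closure_absorb) (use subset_eq_closure[OF sub] sub T' in auto)
        then show False using no P3 by simp
      qed
      then have "0 < ?s (insert e T) * alt_sum F V (insert e T) E"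
        using IH2 P(1,2) P3 by blast
      then show ?thesis unfolding rec' using IH1 by linarith
    qed
    moreover have "0 \<le> ?s T * alt_sum F V T (insert e E)"
      unfolding rec' using IH1 IH2 by linarith
    ultimately show ?thesis by blast
  qed
qed

section \<open>Expansion of the chromatic symmetric function in power sums\<close>

lemma finite_colorings_fibre:
  fixes V :: "'a set"
  assumes "finite V"
  shows "finite {\<kappa> \<in> V \<rightarrow>\<^sub>E {1..}. image_mset \<kappa> (mset_set V) = M}"
proof (rule finite_subset)
  show "{\<kappa> \<in> V \<rightarrow>\<^sub>E {1..}. image_mset \<kappa> (mset_set V) = M} \<subseteq> V \<rightarrow>\<^sub>E set_mset M"
    using assms by (auto simp: PiE_def Pi_def)
  show "finite (V \<rightarrow>\<^sub>E set_mset M)" using assms by (intro finite_PiE) auto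
qed

definition block_colorings :: "'a set set \<Rightarrow> ('a \<Rightarrow> nat) set" where
  "block_colorings \<C> = {\<kappa> \<in> \<Union>\<C> \<rightarrow>\<^sub>E {1..}. \<forall>C\<in>\<C>. \<forall>x\<in>C. \<forall>y\<in>C. \<kappa> x = \<kappa> y}"

text \<open>A coloring that is constant on blocks is a free choice of one colour per block, and a
  block of colour \<open>x\<close> contributes \<open>x\<close> with multiplicity
  \<open>card C\<close>; hence the series factors.\<close>

lemma prod_power_sum:
  assumes "finite \<C>" "\<And>C. C \<in> \<C> \<Longrightarrow> finite C \<and> C \<noteq> {}" "pairwise disjnt \<C>"
  shows "(\<Prod>C\<in>\<C>. power_sum (card C)) =
    gen_series (block_colorings \<C>) (\<lambda>\<kappa>. image_mset \<kappa> (mset_set (\<Union>\<C>)))"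
  using assms
proof (induction \<C> rule: finite_induct)
  case empty
  have "block_colorings {} = {\<lambda>_::'a. undefined}" by (auto simp: block_colorings_def)
  then show ?case
    by (intro series_eqI) (auto simp: mcoeff_gen_series one_series.rep_eq)
next
  case (insert C \<C>)
  let ?U = "\<Union>\<C>"
  obtain c where c: "c \<in> C" using insert.prems by blast
  have fC: "finite C" and fU: "finite ?U" using insert by auto
  have dis: "C \<inter> ?U = {}"
    using insert.prems(2) insert.hyps(2) by (auto simp: pairwise_insert disjnt_def)
  have C1: "1 \<le> card C" using c fC by (metis One_nat_def Suc_leI card_gt_0_iff empty_iff)
  let ?g = "\<lambda>\<kappa>. image_mset \<kappa> (mset_set ?U)"
  have fin: "finite {\<kappa> \<in> block_colorings \<C>. ?g \<kappa> = M}" for M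
    by (rule finite_subset[OF _ finite_colorings_fibre[OF fU, of M]]) (auto simp: block_colorings_def)
  have IH: "(\<Prod>C\<in>\<C>. power_sum (card C)) = gen_series (block_colorings \<C>) ?g"
    using insert by (simp add: pairwise_insert)
  have "(\<Prod>C\<in>insert C \<C>. power_sum (card C)) =
      gen_series {1..} (replicate_mset (card C)) * gen_series (block_colorings \<C>) ?g"
    using insert.hyps IH by (simp add: power_sum_def)
  also have "\<dots> = gen_series ({1..} \<times> block_colorings \<C>)
      (\<lambda>p. replicate_mset (card C) (fst p) + ?g (snd p))"
    by (rule gen_series_times[OF finite_replicate_fibre[OF C1] fin])
  also have "\<dots> = gen_series (block_colorings (insert C \<C>))
      (\<lambda>\<kappa>. image_mset \<kappa> (mset_set (\<Union>(insert C \<C>))))"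
  proof (rule gen_series_reindex)
    let ?h = "\<lambda>p v. if v \<in> C then fst p else snd p v :: nat"
    show "bij_betw ?h ({1..} \<times> block_colorings \<C>) (block_colorings (insert C \<C>))"
    \<comment> \<open>The colour of the block \<open>C\<close> is read off at its representative
      \<open>c\<close>; restricting to \<open>?U\<close> resets the values on \<open>C\<close> to
      \<open>undefined\<close>, as extensionality demands.\<close>
    proof (rule bij_betw_byWitness[where f' = "\<lambda>\<kappa>. (\<kappa> c, restrict \<kappa> ?U)"])
      show "\<forall>p\<in>{1..} \<times> block_colorings \<C>. (?h p c, restrict (?h p) ?U) = p"
      proof
        fix p :: "nat \<times> ('a \<Rightarrow> nat)" assume p: "p \<in> {1..} \<times> block_colorings \<C>"
        obtain x \<kappa> where x\<kappa>: "p = (x, \<kappa>)" by (cases p)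
        then have \<kappa>: "\<kappa> \<in> block_colorings \<C>" using p by simp
        have "restrict (?h (x, \<kappa>)) ?U = \<kappa>"
        proof
          fix v
          show "restrict (?h (x, \<kappa>)) ?U v = \<kappa> v"
            using \<kappa> dis by (cases "v \<in> ?U") (auto simp: block_colorings_def PiE_def extensional_def)
        qed
        then show "(?h p c, restrict (?h p) ?U) = p" using c unfolding x\<kappa> by simp
      qed
      show "\<forall>\<kappa>\<in>block_colorings (insert C \<C>). ?h (\<kappa> c, restrict \<kappa> ?U) = \<kappa>"
      proof
        fix \<kappa> :: "'a \<Rightarrow> nat" assume \<kappa>: "\<kappa> \<in> block_colorings (insert C \<C>)"
        show "?h (\<kappa> c, restrict \<kappa> ?U) = \<kappa>"
        proof
          fix v
          have "\<kappa> v = undefined" if "v \<notin> C" "v \<notin> ?U"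
            using that \<kappa> by (auto simp: block_colorings_def PiE_def extensional_def)
          moreover have "\<kappa> v = \<kappa> c" if "v \<in> C"
            using that c \<kappa> unfolding block_colorings_def by blast
          ultimately show "?h (\<kappa> c, restrict \<kappa> ?U) v = \<kappa> v"
            by (cases "v \<in> C"; cases "v \<in> ?U") (simp_all add: restrict_def)
        qed
      qed
      show "?h ` ({1..} \<times> block_colorings \<C>) \<subseteq> block_colorings (insert C \<C>)"
      proof (rule image_subsetI)
        fix p :: "nat \<times> ('a \<Rightarrow> nat)" assume p: "p \<in> {1..} \<times> block_colorings \<C>"
        obtain x \<kappa> where x\<kappa>: "p = (x, \<kappa>)" by (cases p)
        then have x: "x \<in> {1..}" and \<kappa>: "\<kappa> \<in> block_colorings \<C>" using p by simp_all
        have \<kappa>1: "\<kappa> v \<in> {1..}" if "v \<in> ?U" for v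
          using \<kappa> that unfolding block_colorings_def by blast
        have \<kappa>2: "\<kappa> v = undefined" if "v \<notin> ?U" for v
          using \<kappa> that by (auto simp: block_colorings_def PiE_def extensional_def)
        have \<kappa>3: "\<kappa> v = \<kappa> w" if "D \<in> \<C>" "v \<in> D" "w \<in> D" for v w D
          using \<kappa> that unfolding block_colorings_def by blast
        have \<kappa>4: "v \<notin> C" if "D \<in> \<C>" "v \<in> D" for v D using that dis by blast
        show "?h p \<in> block_colorings (insert C \<C>)"
          unfolding block_colorings_def x\<kappa>
        proof (intro CollectI conjI ballI)
          show "?h (x, \<kappa>) \<in> \<Union>(insert C \<C>) \<rightarrow>\<^sub>E {1..}"
            by (rule PiE_I) (use x \<kappa>1 \<kappa>2 in auto)
        next
          fix D v w assume "D \<in> insert C \<C>" "v \<in> D" "w \<in> D"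
          then show "?h (x, \<kappa>) v = ?h (x, \<kappa>) w"
            using \<kappa>3[of D v w] \<kappa>4[of D v] \<kappa>4[of D w] by (cases "D = C") simp_all
        qed
      qed
      show "(\<lambda>\<kappa>. (\<kappa> c, restrict \<kappa> ?U)) ` block_colorings (insert C \<C>) \<subseteq> {1..} \<times> block_colorings \<C>"
      proof (rule image_subsetI)
        fix \<kappa> :: "'a \<Rightarrow> nat" assume \<kappa>: "\<kappa> \<in> block_colorings (insert C \<C>)"
        have "\<kappa> c \<in> {1..}" using \<kappa> c unfolding block_colorings_def by blast
        moreover have "restrict \<kappa> ?U \<in> block_colorings \<C>"
          unfolding block_colorings_def
        proof (intro CollectI conjI ballI)
          show "restrict \<kappa> ?U \<in> ?U \<rightarrow>\<^sub>E {1..}"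
          proof (rule restrict_PiE_iff[THEN iffD2], rule ballI)
            fix v assume "v \<in> ?U"
            then show "\<kappa> v \<in> {1..}" using \<kappa> unfolding block_colorings_def by blast
          qed
        next
          fix D x y assume D: "D \<in> \<C>" "x \<in> D" "y \<in> D"
          then have "\<kappa> x = \<kappa> y" using \<kappa> unfolding block_colorings_def by blast
          moreover have "x \<in> ?U" "y \<in> ?U" using D by blast+
          ultimately show "restrict \<kappa> ?U x = restrict \<kappa> ?U y" by simp
        qed
        ultimately show "(\<kappa> c, restrict \<kappa> ?U) \<in> {1..} \<times> block_colorings \<C>" by simp
      qed
    qed
  next
    fix p :: "nat \<times> ('a \<Rightarrow> nat)"
    let ?h = "\<lambda>v. if v \<in> C then fst p else snd p v :: nat"
    have 1: "image_mset ?h (mset_set C) = replicate_mset (card C) (fst p)"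
    proof -
      have "image_mset ?h (mset_set C) = image_mset (\<lambda>_. fst p) (mset_set C)"
        by (rule image_mset_cong) (use fC in auto)
      then show ?thesis by (simp add: image_mset_const_eq)
    qed
    have 2: "image_mset ?h (mset_set ?U) = ?g (snd p)"
      by (rule image_mset_cong) (use fU dis in auto)
    have "mset_set (\<Union>(insert C \<C>)) = mset_set C + mset_set ?U"
      using mset_set_Union[OF fC fU dis] by simp
    then show "image_mset ?h (mset_set (\<Union>(insert C \<C>))) =
        replicate_mset (card C) (fst p) + ?g (snd p)"
      by (simp add: 1 2)
  qed
  finally show ?case .
qed

text \<open>The power sum product indexed by the block sizes of the partition
  \<open>P\<close>.\<close>

definition block_prod :: "'a set \<Rightarrow> 'a rel \<Rightarrow> series" where
  "block_prod V P = (\<Prod>C\<in>V // P. power_sum (card C))"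

lemma
  assumes "finite V" "equiv V P"
  shows finite_quotient_equiv: "finite (V // P)"
    and quotient_block: "C \<in> V // P \<Longrightarrow> finite C \<and> C \<noteq> {}"
    and pairwise_disjnt_quotient: "pairwise disjnt (V // P)"
proof -
  show "finite (V // P)" using assms(1) by (simp add: quotient_def)
  show "pairwise disjnt (V // P)"
    using quotient_disj[OF assms(2)] by (auto simp: pairwise_def disjnt_def)
  show "finite C \<and> C \<noteq> {}" if "C \<in> V // P"
    using that assms in_quotient_imp_non_empty[OF assms(2) that] in_quotient_imp_subset[OF assms(2) that]
    by (auto intro: finite_subset)
qed

text \<open>Inclusion-exclusion over the monochromatic edges: expand the product of
  \<open>1 - of_bool (\<kappa> u = \<kappa> v)\<close> over \<open>E\<close> and exchange the sums.
  The colorings monochromatic on \<open>S\<close> are those constant on its components. Stating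
  properness through \<open>E\<close> allows one arc per edge.\<close>

lemma csf_expansion:
  fixes G :: "'a pair_pre_digraph"
  defines "V \<equiv> pverts G"
  assumes V: "finite V" and E: "finite E" "E \<subseteq> V \<times> V"
    and proper: "\<And>\<kappa> :: 'a \<Rightarrow> nat. (\<forall>(u, v)\<in>parcs G. \<kappa> u \<noteq> \<kappa> v) \<longleftrightarrow> (\<forall>(u, v)\<in>E. \<kappa> u \<noteq> \<kappa> v)"
  shows "csf G = (\<Sum>S\<in>Pow E. (-1) ^ card S *\<^sub>s block_prod V (eq_closure V S))"
proof (rule series_eqI)
  fix M :: "nat multiset"
  \<comment> \<open>Fixing the monomial \<open>M\<close> leaves finitely many colorings, so the sums
    can be exchanged.\<close>
  define A where "A = {\<kappa> \<in> V \<rightarrow>\<^sub>E {1..}. image_mset \<kappa> (mset_set V) = M}"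
  have A: "finite A" unfolding A_def by (rule finite_colorings_fibre[OF V])
  have ind: "(\<Prod>x\<in>X. of_bool (Q x)) = (of_bool (\<forall>x\<in>X. Q x) :: rat)" if "finite X"
    for X :: "('a \<times> 'a) set" and Q
    using that by (induction X rule: finite_induct) auto
  have count: "of_nat (card {\<kappa> \<in> A. Q \<kappa>}) = (\<Sum>\<kappa>\<in>A. of_bool (Q \<kappa>) :: rat)" for Q
    using A by (simp add: of_bool_def sum.If_cases Int_def)
  have blocks: "mcoeff (block_prod V (eq_closure V S)) M =
      (\<Sum>\<kappa>\<in>A. of_bool (\<forall>e\<in>S. \<kappa> (fst e) = \<kappa> (snd e)))" if S: "S \<subseteq> E" for S
  proof -
    let ?R = "eq_closure V S"
    have R: "equiv V ?R" by (rule equiv_eq_closure)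
    have SV: "S \<subseteq> V \<times> V" using S E by blast
    have "(\<forall>C\<in>V // ?R. \<forall>x\<in>C. \<forall>y\<in>C. \<kappa> x = \<kappa> y) \<longleftrightarrow> (\<forall>e\<in>S. \<kappa> (fst e) = \<kappa> (snd e))"
      (is "?L \<longleftrightarrow> ?E") for \<kappa> :: "'a \<Rightarrow> nat"
    proof
      assume L: ?L
      show ?E
      proof
        fix e assume e: "e \<in> S"
        then have "e \<in> ?R" "fst e \<in> V" using subset_eq_closure[OF SV] SV by auto
        then have "fst e \<in> ?R `` {fst e}" "snd e \<in> ?R `` {fst e}" "?R `` {fst e} \<in> V // ?R"
          using equiv_class_self[OF R] by (auto intro: quotientI)
        then show "\<kappa> (fst e) = \<kappa> (snd e)" using L by blast
      qed
    next
      assume *: ?E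
      \<comment> \<open>Having equal colours is an equivalence that contains \<open>S\<close>, hence
        also its closure.\<close>
      let ?K = "{(x, y) \<in> V \<times> V. \<kappa> x = \<kappa> y}"
      have "equiv V ?K" by (rule equivI) (auto simp: refl_on_def sym_def trans_def)
      moreover have "S \<subseteq> ?K" using * SV by auto
      ultimately have "?R \<subseteq> ?K" by (rule eq_closure_least)
      moreover have "(x, y) \<in> ?R" if "C \<in> V // ?R" "x \<in> C" "y \<in> C" for C x y
        using quotient_eq_iff[OF R that(1,1,2,3)] by simp
      ultimately show ?L by blast
    qed
    moreover have "\<Union>(V // ?R) = V" by (rule Union_quotient[OF R])
    ultimately have "{\<kappa> \<in> block_colorings (V // ?R). image_mset \<kappa> (mset_set (\<Union>(V // ?R))) = M} =
        {\<kappa> \<in> A. \<forall>e\<in>S. \<kappa> (fst e) = \<kappa> (snd e)}"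
      unfolding block_colorings_def A_def by auto
    moreover have "block_prod V ?R =
        gen_series (block_colorings (V // ?R)) (\<lambda>\<kappa>. image_mset \<kappa> (mset_set (\<Union>(V // ?R))))"
      unfolding block_prod_def
      by (rule prod_power_sum)
        (use finite_quotient_equiv[OF V R] quotient_block[OF V R] pairwise_disjnt_quotient[OF V R] in auto)
    ultimately show ?thesis by (simp add: mcoeff_gen_series count)
  qed
  have "{\<kappa> \<in> proper_colorings G. image_mset \<kappa> (mset_set (pverts G)) = M} =
      {\<kappa> \<in> A. \<forall>e\<in>E. \<not> \<kappa> (fst e) = \<kappa> (snd e)}"
    unfolding proper_colorings_def A_def V_def proper by auto
  then have "mcoeff (csf G) M = (\<Sum>\<kappa>\<in>A. of_bool (\<forall>e\<in>E. \<not> \<kappa> (fst e) = \<kappa> (snd e)))"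
    by (simp add: csf.rep_eq count)
  also have "\<dots> = (\<Sum>\<kappa>\<in>A. \<Prod>e\<in>E. 1 - of_bool (\<kappa> (fst e) = \<kappa> (snd e)))"
    by (simp add: ind[OF E(1), symmetric] of_bool_not_iff)
  also have "\<dots> = (\<Sum>\<kappa>\<in>A. \<Sum>S\<in>Pow E. (-1) ^ card S * of_bool (\<forall>e\<in>S. \<kappa> (fst e) = \<kappa> (snd e)))"
    using E(1) finite_subset[OF _ E(1)]
    by (intro sum.cong refl) (simp add: prod_diff_conv_sum[OF E(1)] ind)
  also have "\<dots> = (\<Sum>S\<in>Pow E. (-1) ^ card S * (\<Sum>\<kappa>\<in>A. of_bool (\<forall>e\<in>S. \<kappa> (fst e) = \<kappa> (snd e))))"
    by (subst sum.swap) (simp add: sum_distrib_left)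
  also have "\<dots> = mcoeff (\<Sum>S\<in>Pow E. (-1) ^ card S *\<^sub>s block_prod V (eq_closure V S)) M"
    by (simp add: mcoeff_sum smult_series.rep_eq blocks)
  finally show "mcoeff (csf G) M =
      mcoeff (\<Sum>S\<in>Pow E. (-1) ^ card S *\<^sub>s block_prod V (eq_closure V S)) M" .
qed

section \<open>Coefficients of power sum products at one and two parts\<close>

lemma e_graded_block_prod:
  assumes V: "finite V" and P: "equiv V P"
  shows "e_graded (card (V // P)) (card V) (block_prod V P)"
proof -
  have "e_graded 1 (card C) (power_sum (card C))" if "C \<in> V // P" for C
    using quotient_block[OF V P that] by (intro e_graded_power_sum) (simp add: Suc_le_eq card_gt_0_iff)
  then have "e_graded (card (V // P)) (\<Sum>C\<in>V // P. card C) (block_prod V P)"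
    unfolding block_prod_def by (rule e_graded_prod) (use finite_quotient_equiv[OF V P] in auto)
  moreover have "(\<Sum>C\<in>V // P. card C) = card (\<Union>(V // P))"
    using pairwise_disjnt_quotient[OF V P] quotient_block[OF V P]
    by (intro card_Union_disjoint[symmetric]) auto
  ultimately show ?thesis by (simp add: Union_quotient[OF P])
qed

lemma block_prod_single:
  assumes "equiv V P" "card (V // P) = 1"
  shows "block_prod V P = power_sum (card V)"
proof -
  obtain C where C: "V // P = {C}" using assms(2) by (meson card_1_singletonE)
  then have "C = V" using Union_quotient[OF assms(1)] by simp
  with C show ?thesis by (simp add: block_prod_def)
qed

text \<open>Every block contributes at least one part, so two or more blocks cannot produce a
  single-part partition.\<close>

lemma e_coeff_single_block_prod:
  assumes V: "finite V" "V \<noteq> {}" and P: "equiv V P"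
  shows "e_coeff {#card V#} (block_prod V P) =
    (-1) ^ (card V - 1) * of_nat (card V) * of_bool (card (V // P) = 1)"
proof (cases "card (V // P) = 1")
  case True
  have "1 \<le> card V" using V by (simp add: Suc_le_eq card_gt_0_iff)
  with True show ?thesis using e_coeff_power_sum by (simp add: block_prod_single[OF P])
next
  case False
  have "V // P \<noteq> {}" using V(2) by (auto simp: quotient_def)
  then have "card (V // P) \<noteq> 0" using finite_quotient_equiv[OF V(1) P] by simp
  then have "\<not> card (V // P) \<le> size {#card V#}" using False by simp
  then have "e_coeff {#card V#} (block_prod V P) = 0"
    using e_graded_block_prod[OF V(1) P] by (auto simp: e_graded_def)
  then show ?thesis using False by simp
qed

text \<open>Each factor contributes at least one part, so a two-part partition takes exactly one
  from each, and the degrees fix these as \<open>c\<close> and \<open>d\<close>. Even for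
  \<open>c = d\<close> only one ordered splitting contributes.\<close>

lemma e_coeff_pair_times:
  assumes "c \<ge> 1" "d \<ge> 1"
  shows "e_coeff {#a, b#} (power_sum c * power_sum d) =
    (-1) ^ (c + d) * of_nat (c * d) * of_bool ({#a, b#} = {#c, d#})"
proof -
  let ?f = "\<lambda>(X, Y). e_coeff X (power_sum c) * e_coeff Y (power_sum d)"
  have c: "e_graded 1 c (power_sum c)" and d: "e_graded 1 d (power_sum d)"
    using assms by (simp_all add: e_graded_power_sum del: One_nat_def)
  have eq: "e_coeff {#a, b#} (power_sum c * power_sum d) = (\<Sum>p | case p of (X, Y) \<Rightarrow> X + Y = {#a, b#}. ?f p)"
    using c d by (simp add: e_coeff_mult e_graded_expandable)
  have only: "p = ({#c#}, {#d#})" if p: "p \<in> {(X, Y). X + Y = {#a, b#}}" "?f p \<noteq> 0" for p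
  proof -
    obtain X Y where XY: "p = (X, Y)" by (cases p)
    have s: "1 \<le> size X \<and> \<Sum>\<^sub># X = c" "1 \<le> size Y \<and> \<Sum>\<^sub># Y = d"
      using c d p(2) by (auto simp: XY e_graded_def)
    have "size X + size Y = size {#a, b#}" 
    proof -
      have "X + Y = {#a, b#}" using p(1) XY by blast
      then show ?thesis by (metis size_union)
    qed
    then have "size X = 1" "size Y = 1" using s by auto
    then obtain x y where "X = {#x#}" "Y = {#y#}" by (metis One_nat_def size_1_singleton_mset)
    then show ?thesis using s XY by simp
  qed
  show ?thesis
  proof (cases "{#a, b#} = {#c, d#}")
    case True
    have "(\<Sum>p | case p of (X, Y) \<Rightarrow> X + Y = {#a, b#}. ?f p) = (\<Sum>p\<in>{({#c#}, {#d#})}. ?f p)"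
    proof (rule sum.mono_neutral_right)
      show "\<forall>p\<in>{(X, Y). X + Y = {#a, b#}} - {({#c#}, {#d#})}. ?f p = 0"
        using only by blast
      show "{({#c#}, {#d#})} \<subseteq> {(X, Y). X + Y = {#a, b#}}" using True by simp
    qed (rule finite_msplits)
    also have "\<dots> = (-1) ^ ((c - 1) + (d - 1)) * of_nat (c * d)"
      using assms unfolding power_add by (simp add: e_coeff_power_sum)
    also have "(-1) ^ ((c - 1) + (d - 1)) = ((-1) ^ (c + d) :: rat)"
      using assms by (cases c; cases d) simp_all
    finally show ?thesis using eq True by simp
  next
    case False
    have "(\<Sum>p | case p of (X, Y) \<Rightarrow> X + Y = {#a, b#}. ?f p) = 0"
    proof (rule sum.neutral, rule ballI, rule ccontr)
      fix p assume p: "p \<in> {(X, Y). X + Y = {#a, b#}}" "?f p \<noteq> 0"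
      then have "({#c#}, {#d#}) \<in> {(X, Y). X + Y = {#a, b#}}" using only by metis
      then show False using False by simp
    qed
    then show ?thesis using eq False by simp
  qed
qed

text \<open>The correction by \<open>[e\<^bsub>(n)\<^esub>]\<close> makes the functional vanish on \<open>p\<^sub>n\<close>,
  so that among the power sum products of degree \<open>n\<close> it only sees \<open>p\<^sub>a p\<^sub>b\<close>.\<close>

definition pair_fun :: "nat \<Rightarrow> nat \<Rightarrow> series \<Rightarrow> rat" where
  "pair_fun a b F = e_coeff {#a, b#} F -
     e_coeff {#a, b#} (power_sum (a + b)) / e_coeff {#a + b#} (power_sum (a + b)) * e_coeff {#a + b#} F"

text \<open>By the number of blocks: for one the correction cancels the coefficient, for two the
  correction is 0 and \<open>e_coeff_pair_times\<close> decides, and three or more force more parts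
  than either coefficient has.\<close>

lemma pair_fun_block_prod:
  assumes V: "finite V" and P: "equiv V P" and ab: "a \<ge> 1" "b \<ge> 1" "a + b = card V"
  shows "pair_fun a b (block_prod V P) =
    (-1) ^ card V * of_nat (a * b) * of_bool (image_mset card (mset_set (V // P)) = {#a, b#})"
proof -
  note fin = finite_quotient_equiv[OF V P]
  note graded = e_graded_block_prod[OF V P]
  have "V \<noteq> {}" using ab by auto
  then have "V // P \<noteq> {}" by (auto simp: quotient_def)
  then have "card (V // P) \<noteq> 0" using fin by simp
  then consider "card (V // P) = 1" | "card (V // P) = 2" | "card (V // P) \<ge> 3" by linarith
  then show ?thesis
  proof cases
    case 1
    have "e_coeff {#a + b#} (power_sum (a + b)) \<noteq> 0" using e_coeff_power_sum[of "a + b"] ab by simp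
    then have "pair_fun a b (block_prod V P) = 0"
      using ab by (simp add: pair_fun_def block_prod_single[OF P 1])
    moreover have "image_mset card (mset_set (V // P)) \<noteq> {#a, b#}"
    proof
      assume "image_mset card (mset_set (V // P)) = {#a, b#}"
      from arg_cong[OF this, of size] show False using 1 by simp
    qed
    ultimately show ?thesis by simp
  next
    case 2
    then obtain A B where AB: "V // P = {A, B}" "A \<noteq> B" by (meson card_2_iff)
    then have ge: "card A \<ge> 1" "card B \<ge> 1"
      using quotient_block[OF V P] by (auto simp: Suc_le_eq card_gt_0_iff)
    have bp: "block_prod V P = power_sum (card A) * power_sum (card B)"
      using AB by (simp add: block_prod_def)
    have im: "image_mset card (mset_set (V // P)) = {#card A, card B#}"
      using AB by simp
    have "e_coeff {#a + b#} (block_prod V P) = 0"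
      using e_coeff_single_block_prod[OF V \<open>V \<noteq> {}\<close> P] 2 ab by simp
    then have pf: "pair_fun a b (block_prod V P) =
        (-1) ^ (card A + card B) * of_nat (card A * card B) * of_bool ({#a, b#} = {#card A, card B#})"
      using e_coeff_pair_times[OF ge] by (simp add: pair_fun_def bp)
    show ?thesis
    proof (cases "{#a, b#} = {#card A, card B#}")
      case True
      then have "a = card A \<and> b = card B \<or> a = card B \<and> b = card A"
        by (auto simp: add_eq_conv_ex)
      then have "card A + card B = card V" "card A * card B = a * b" using ab by auto
      then show ?thesis using pf True im by simp
    next
      case False
      then have "image_mset card (mset_set (V // P)) \<noteq> {#a, b#}" unfolding im by metis
      with False show ?thesis unfolding pf by (simp only: of_bool_eq(1) mult_zero_right simp_thms)
    qed
  next
    case 3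
    then have "\<not> card (V // P) \<le> size {#a, b#}" "\<not> card (V // P) \<le> size {#a + b#}" by simp_all
    then have "e_coeff {#a, b#} (block_prod V P) = 0" "e_coeff {#a + b#} (block_prod V P) = 0"
      using graded by (auto simp: e_graded_def)
    then have "pair_fun a b (block_prod V P) = 0" by (simp add: pair_fun_def)
    moreover have "image_mset card (mset_set (V // P)) \<noteq> {#a, b#}"
    proof
      assume "image_mset card (mset_set (V // P)) = {#a, b#}"
      from arg_cong[OF this, of size] show False using 3 by simp
    qed
    ultimately show ?thesis by simp
  qed
qed

section \<open>Connected graphs\<close>

lemma pair_graphD:
  assumes "pair_graph G"
  shows "finite (pverts G)" "parcs G \<subseteq> pverts G \<times> pverts G" "sym (parcs G)" "(v, v) \<notin> parcs G"
proof -
  interpret pair_graph G by fact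
  show "finite (pverts G)" by (rule pair_finite_verts)
  show "parcs G \<subseteq> pverts G \<times> pverts G" using in_arcsD1 in_arcsD2 by auto
  show "(v, v) \<notin> parcs G" using pair_no_loops[of "(v, v)"] by auto
  show "sym (parcs G)" using symmetric_conv by (auto intro!: symI sym_arcs arcs_symmetric)
qed

lemma connected_iff_rtrancl:
  assumes "pair_graph G"
  shows "Digraph_Component.connected (with_proj G) \<longleftrightarrow>
    pverts G \<noteq> {} \<and> (\<forall>u\<in>pverts G. \<forall>v\<in>pverts G. (u, v) \<in> (parcs G)\<^sup>*)"
proof -
  note G = pair_graphD[OF assms]
  have ms: "parcs (mk_symmetric (with_proj G)) = parcs G"
    using G(3) by (auto simp: mk_symmetric_def dest: symD)
  have "(u, v) \<in> rtrancl_on (pverts G) (parcs G) \<longleftrightarrow> (u, v) \<in> (parcs G)\<^sup>*"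
    if "u \<in> pverts G" "v \<in> pverts G" for u v
    using that G(2) by (auto intro: rtrancl_consistent_rtrancl_on rtrancl_on_rtranclI)
  then show ?thesis
    by (auto simp: Digraph_Component.connected_def strongly_connected_def reachable_def ms)
qed

lemma rtrancl_cut:
  assumes "(x, y) \<in> r\<^sup>*" "x \<in> X" "y \<notin> X"
  obtains u v where "(u, v) \<in> r" "u \<in> X" "v \<notin> X"
  using assms by (induction rule: rtrancl_induct) blast+

lemma conn_graphs_cut:
  assumes "G \<in> conn_graphs n" "x \<in> X" "x \<in> pverts G" "y \<notin> X" "y \<in> pverts G"
  obtains u v where "(u, v) \<in> parcs G" "u \<in> X" "v \<notin> X"
proof -
  have "pair_graph G" "Digraph_Component.connected (with_proj G)"
    using assms(1) by (simp_all add: conn_graphs_def)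
  then have "(x, y) \<in> (parcs G)\<^sup>*" using assms(3,5) connected_iff_rtrancl by blast
  then show thesis using assms(2,4) that by (rule rtrancl_cut)
qed

lemma exists_vertex_outside:
  assumes "finite V" "finite X" "card X < card V"
  obtains y where "y \<in> V" "y \<notin> X"
  using assms by (meson card_mono not_le subsetI)

section \<open>Disjoint edges and splittings into connected parts\<close>

text \<open>Pairwise intersecting edges form a star or a triangle, and the triangle is excluded by a
  fourth vertex and connectedness. The centre \<open>w\<close> is found as a vertex with two
  neighbours \<open>x\<close> and \<open>p\<close>.\<close>

lemma star_if_no_disjoint_edges:
  assumes G: "G \<in> conn_graphs n" and n: "n \<ge> 4"
    and no: "\<And>a b c d. (a, b) \<in> parcs G \<Longrightarrow> (c, d) \<in> parcs G \<Longrightarrow> {a, b} \<inter> {c, d} \<noteq> {}"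
  obtains w where "w \<in> pverts G"
    "parcs G = {w} \<times> (pverts G - {w}) \<union> (pverts G - {w}) \<times> {w}"
proof -
  let ?V = "pverts G"
  have pg: "pair_graph G" and cV: "card ?V = n" using G by (simp_all add: conn_graphs_def)
  note F = pair_graphD[OF pg]
  have symm: "(b, a) \<in> parcs G" if "(a, b) \<in> parcs G" for a b using F(3) that by (rule symD)
  have inV: "a \<in> ?V" "b \<in> ?V" "a \<noteq> b" if "(a, b) \<in> parcs G" for a b
    using that F(2,4) by auto
  have out: "\<exists>y. y \<in> ?V \<and> y \<notin> X" if "finite X" "card X < 4" for X
    using exists_vertex_outside[OF F(1) that(1)] that(2) cV n by (metis less_le_trans)
  obtain x0 where "x0 \<in> ?V" using out[of "{}"] by auto
  moreover obtain y0 where "y0 \<in> ?V" "y0 \<notin> {x0}" using out[of "{x0}"] by auto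
  ultimately obtain u v where uv: "(u, v) \<in> parcs G" using conn_graphs_cut[OF G, of x0 "{x0}" y0] by blast
  have "card {u, v} < 4" by (simp add: card_insert_if)
  then obtain y1 where "y1 \<in> ?V" "y1 \<notin> {u, v}" using out[of "{u, v}"] by auto
  then obtain w x where wx: "(w, x) \<in> parcs G" "w \<in> {u, v}" "x \<notin> {u, v}"
    using conn_graphs_cut[OF G, of u "{u, v}" y1] inV[OF uv] by blast
  \<comment> \<open>\<open>p\<close> is the other end of the first edge; \<open>x\<close> lies
    outside that edge and so differs from \<open>p\<close>.\<close>
  obtain p where wp: "(w, p) \<in> parcs G" "p \<noteq> x" using uv symm[OF uv] wx by blast
  note inV1 = inV[OF wx(1)] inV[OF wp(1)]
  have adj: "(w, y) \<in> parcs G" if y: "y \<in> ?V" "y \<noteq> w" for y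
  proof -
    consider "y = x" | "y = p" | "y \<notin> {w, x, p}" using y by blast
    then show ?thesis
    proof cases
      case 3
      obtain y' z where z: "(y', z) \<in> parcs G" "y' \<in> {y}" "z \<notin> {y}"
        using conn_graphs_cut[OF G, of y "{y}" w] y inV1 by blast
      \<comment> \<open>The edge at \<open>y\<close> meets both \<open>{w, x}\<close> and
        \<open>{w, p}\<close> but not in \<open>y\<close>, so its other end is their common
        vertex.\<close>
      have "z = w" using no[OF z(1) wx(1)] no[OF z(1) wp(1)] z 3 wp(2) by auto
      then show ?thesis using z symm by blast
    qed (use wx wp in auto)
  qed
  have "s = w \<or> t = w" if st: "(s, t) \<in> parcs G" for s t
  proof (rule ccontr)
    assume c: "\<not> (s = w \<or> t = w)"
    \<comment> \<open>An edge \<open>(s, t)\<close> avoiding \<open>w\<close> would be disjoint from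
      the edge from \<open>w\<close> to a fourth vertex \<open>q\<close>.\<close>
    have "card {w, s, t} < 4" by (simp add: card_insert_if)
    then obtain q where q: "q \<in> ?V" "q \<notin> {w, s, t}" using out[of "{w, s, t}"] by auto
    then have "(w, q) \<in> parcs G" using adj by blast
    then show False using no[OF st] c q by blast
  qed
  then have "parcs G \<subseteq> {w} \<times> (?V - {w}) \<union> (?V - {w}) \<times> {w}"
  proof (intro subrelI)
    fix s t assume st: "(s, t) \<in> parcs G" and "\<And>s t. (s, t) \<in> parcs G \<Longrightarrow> s = w \<or> t = w"
    then have "s = w \<or> t = w" by blast
    with inV[OF st] show "(s, t) \<in> {w} \<times> (?V - {w}) \<union> (?V - {w}) \<times> {w}" by auto
  qed
  moreover have "{w} \<times> (?V - {w}) \<union> (?V - {w}) \<times> {w} \<subseteq> parcs G"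
    using adj symm by auto
  ultimately have "parcs G = {w} \<times> (?V - {w}) \<union> (?V - {w}) \<times> {w}" by (rule equalityI)
  with inV1 show thesis using that by blast
qed

definition induced_conn :: "'a pair_pre_digraph \<Rightarrow> 'a set \<Rightarrow> bool" where
  "induced_conn G A \<longleftrightarrow> (\<forall>x\<in>A. \<forall>y\<in>A. (x, y) \<in> (parcs G \<inter> A \<times> A)\<^sup>*)"

lemma induced_conn_insert:
  assumes A: "induced_conn G A" and uv: "u \<in> A" "(u, v) \<in> parcs G" and symG: "sym (parcs G)"
  shows "induced_conn G (insert v A)"
proof -
  let ?r = "parcs G \<inter> insert v A \<times> insert v A"
  have "(parcs G \<inter> A \<times> A)\<^sup>* \<subseteq> ?r\<^sup>*" by (rule rtrancl_mono) auto
  then have inA: "(x, y) \<in> ?r\<^sup>*" if "x \<in> A" "y \<in> A" for x y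
    using A that unfolding induced_conn_def by blast
  have e: "(u, v) \<in> ?r" "(v, u) \<in> ?r" using uv symG by (auto dest: symD)
  have xv: "(x, v) \<in> ?r\<^sup>*" if "x \<in> insert v A" for x
  proof (cases "x = v")
    case False
    then have "(x, u) \<in> ?r\<^sup>*" using inA that uv(1) by blast
    then show ?thesis using e(1) by (rule rtrancl_into_rtrancl)
  qed simp
  have vy: "(v, y) \<in> ?r\<^sup>*" if "y \<in> insert v A" for y
  proof (cases "y = v")
    case False
    then have "(u, y) \<in> ?r\<^sup>*" using inA that uv(1) by blast
    then show ?thesis by (rule converse_rtrancl_into_rtrancl[OF e(2)])
  qed simp
  show ?thesis unfolding induced_conn_def using rtrancl_trans[OF xv vy] by blast
qed

lemma induced_conn_edge: "(u, v) \<in> parcs G \<Longrightarrow> sym (parcs G) \<Longrightarrow> induced_conn G {u, v}"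
  using induced_conn_insert[of G "{u}" u v] by (simp add: induced_conn_def insert_commute)

text \<open>Greedy growth: while vertices are left over, connectedness of the graph gives an arc
  leaving \<open>A \<union> B\<close>, and its head joins the side of its tail. The induction is on
  the number of vertices left over.\<close>

lemma extend_connected_pair:
  assumes G: "G \<in> conn_graphs n"
    and "A \<inter> B = {}" "A \<union> B \<subseteq> pverts G" "A \<noteq> {}" "induced_conn G A" "induced_conn G B"
  shows "\<exists>A' B'. A \<subseteq> A' \<and> B \<subseteq> B' \<and> A' \<inter> B' = {} \<and> A' \<union> B' = pverts G \<and>
    induced_conn G A' \<and> induced_conn G B'"
  using assms(2-)
proof (induction "card (pverts G - (A \<union> B))" arbitrary: A B)
  case 0
  have "finite (pverts G)" using G pair_graphD by (auto simp: conn_graphs_def)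
  then have "A \<union> B = pverts G" using 0 by auto
  then show ?case using 0 by blast
next
  case (Suc k)
  have pg: "pair_graph G" using G by (simp add: conn_graphs_def)
  note F = pair_graphD[OF pg]
  obtain y where y: "y \<in> pverts G" "y \<notin> A \<union> B"
    using Suc.hyps(2) by (metis Diff_eq_empty_iff card.empty nat.distinct(1) subsetI)
  obtain x where x: "x \<in> A" using Suc.prems by blast
  obtain u v where uv: "(u, v) \<in> parcs G" "u \<in> A \<union> B" "v \<notin> A \<union> B"
    using conn_graphs_cut[OF G, of x "A \<union> B" y] x y Suc.prems(2) by blast
  have vV: "v \<in> pverts G" using uv F(2) by blast
  have "pverts G - insert v (A \<union> B) = (pverts G - (A \<union> B)) - {v}" by blast
  then have k: "k = card (pverts G - insert v (A \<union> B))"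
    using Suc.hyps(2) vV uv(3) F(1) by simp
  show ?case
  proof (cases "u \<in> A")
    case True
    have "\<exists>A' B'. insert v A \<subseteq> A' \<and> B \<subseteq> B' \<and> A' \<inter> B' = {} \<and> A' \<union> B' = pverts G \<and>
      induced_conn G A' \<and> induced_conn G B'"
    proof (rule Suc.hyps(1))
      show "k = card (pverts G - (insert v A \<union> B))" using k by simp
      show "induced_conn G (insert v A)" by (rule induced_conn_insert[OF Suc.prems(4) True uv(1) F(3)])
    qed (use Suc.prems(1,2,5) uv(3) vV in auto)
    then show ?thesis by (meson insert_subset)
  next
    case False
    then have uB: "u \<in> B" using uv by blast
    have "\<exists>A' B'. A \<subseteq> A' \<and> insert v B \<subseteq> B' \<and> A' \<inter> B' = {} \<and> A' \<union> B' = pverts G \<and>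
      induced_conn G A' \<and> induced_conn G B'"
    proof (rule Suc.hyps(1))
      show "k = card (pverts G - (A \<union> insert v B))" using k by simp
      show "induced_conn G (insert v B)" by (rule induced_conn_insert[OF Suc.prems(5) uB uv(1) F(3)])
    qed (use Suc.prems(1-4) uv(3) vV in auto)
    then show ?thesis by (meson insert_subset)
  qed
qed

section \<open>Coefficients of chromatic symmetric functions\<close>

text \<open>One arc per edge, chosen by the order of the vertex numbers.\<close>

definition edge_set :: "nat pair_pre_digraph \<Rightarrow> nat rel" where
  "edge_set G = {(u, v) \<in> parcs G. u < v}"

lemma edge_set_sym_closure:
  assumes "pair_graph G"
  shows "edge_set G \<union> (edge_set G)\<inverse> = parcs G"
proof -
  have "u < v \<or> v < u" if "(u, v) \<in> parcs G" for u v
    using that pair_graphD(4)[OF assms, of u] by (cases "u = v") auto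
  then show ?thesis using pair_graphD(3)[OF assms] by (auto simp: edge_set_def dest: symD)
qed

lemma csf_edge_set_expansion:
  assumes "pair_graph G"
  shows "csf G = (\<Sum>S\<in>Pow (edge_set G). (-1) ^ card S *\<^sub>s block_prod (pverts G) (eq_closure (pverts G) S))"
proof (rule csf_expansion)
  note F = pair_graphD[OF assms]
  show "finite (pverts G)" by (rule F)
  show E: "edge_set G \<subseteq> pverts G \<times> pverts G" using F(2) by (auto simp: edge_set_def)
  show "finite (edge_set G)" by (rule finite_subset[OF E]) (use F(1) in simp)
  fix \<kappa> :: "nat \<Rightarrow> nat"
  show "(\<forall>(u, v)\<in>parcs G. \<kappa> u \<noteq> \<kappa> v) \<longleftrightarrow> (\<forall>(u, v)\<in>edge_set G. \<kappa> u \<noteq> \<kappa> v)"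
    unfolding edge_set_sym_closure[OF assms, symmetric] by auto
qed

lemma csf_e_expandable:
  fixes G :: "nat pair_pre_digraph"
  assumes "pair_graph G"
  shows "e_expandable (csf G)"
  unfolding csf_edge_set_expansion[OF assms]
  by (intro e_expandable_sum e_expandable_smult e_graded_expandable[OF e_graded_block_prod]
      pair_graphD(1)[OF assms] equiv_eq_closure)

lemma pair_fun_sum:
  assumes "\<And>x. x \<in> A \<Longrightarrow> e_expandable (f x)"
  shows "pair_fun a b (\<Sum>x\<in>A. c x *\<^sub>s f x) = (\<Sum>x\<in>A. c x * pair_fun a b (f x))"
proof -
  have "e_coeff lam (\<Sum>x\<in>A. c x *\<^sub>s f x) = (\<Sum>x\<in>A. c x * e_coeff lam (f x))" for lam
    using assms by (simp add: e_coeff_sum e_coeff_smult e_expandable_smult)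
  then show ?thesis
    unfolding pair_fun_def right_diff_distrib sum_subtractf
    by (simp add: sum_distrib_left mult.left_commute)
qed

text \<open>Both functionals turn a power sum product into a constant times an indicator of its
  partition type; the constant leaves the sum.\<close>

lemma
  assumes G: "pair_graph G" "pverts G \<noteq> {}"
  defines "V \<equiv> pverts G"
  shows e_coeff_single_csf: "e_coeff {#card V#} (csf G) = (-1) ^ (card V - 1) * of_nat (card V) *
      alt_sum (\<lambda>P. of_bool (card (V // P) = 1)) V {} (edge_set G)"
    and pair_fun_csf: "\<lbrakk>a \<ge> 1; b \<ge> 1; a + b = card V\<rbrakk> \<Longrightarrow> pair_fun a b (csf G) =
      (-1) ^ card V * of_nat (a * b) *
      alt_sum (\<lambda>P. of_bool (image_mset card (mset_set (V // P)) = {#a, b#})) V {} (edge_set G)"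
proof -
  have V: "finite V" "V \<noteq> {}" using pair_graphD(1)[OF G(1)] G(2) by (simp_all add: V_def)
  let ?R = "eq_closure V"
  have ex: "e_expandable (block_prod V (?R S))" for S
    by (rule e_graded_expandable[OF e_graded_block_prod[OF V(1) equiv_eq_closure]])
  have csf: "csf G = (\<Sum>S\<in>Pow (edge_set G). (-1) ^ card S *\<^sub>s block_prod V (?R S))"
    unfolding V_def by (rule csf_edge_set_expansion[OF G(1)])
  have "e_coeff {#card V#} (csf G) =
      (\<Sum>S\<in>Pow (edge_set G). (-1) ^ card S * e_coeff {#card V#} (block_prod V (?R S)))"
    unfolding csf by (simp add: e_coeff_sum e_coeff_smult e_expandable_smult ex)
  also have "\<dots> = (-1) ^ (card V - 1) * of_nat (card V) *
      alt_sum (\<lambda>P. of_bool (card (V // P) = 1)) V {} (edge_set G)"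
    unfolding alt_sum_def sum_distrib_left
    by (rule sum.cong) (simp_all add: e_coeff_single_block_prod[OF V equiv_eq_closure])
  finally show "e_coeff {#card V#} (csf G) = (-1) ^ (card V - 1) * of_nat (card V) *
      alt_sum (\<lambda>P. of_bool (card (V // P) = 1)) V {} (edge_set G)" .
  assume ab: "a \<ge> 1" "b \<ge> 1" "a + b = card V"
  have "pair_fun a b (csf G) =
      (\<Sum>S\<in>Pow (edge_set G). (-1) ^ card S * pair_fun a b (block_prod V (?R S)))"
    unfolding csf by (rule pair_fun_sum) (rule ex)
  also have "\<dots> = (-1) ^ card V * of_nat (a * b) *
      alt_sum (\<lambda>P. of_bool (image_mset card (mset_set (V // P)) = {#a, b#})) V {} (edge_set G)"
    unfolding alt_sum_def sum_distrib_left
    by (rule sum.cong) (simp_all add: pair_fun_block_prod[OF V(1) equiv_eq_closure ab])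
  finally show "pair_fun a b (csf G) = (-1) ^ card V * of_nat (a * b) *
      alt_sum (\<lambda>P. of_bool (image_mset card (mset_set (V // P)) = {#a, b#})) V {} (edge_set G)" .
qed

section \<open>Positivity of the two functionals\<close>

text \<open>The strict case of \<open>alt_sum_sign\<close> with nothing contracted yet, when all
  \<open>card (pverts G)\<close> classes are singletons. The assumption \<open>conn\<close> makes
  \<open>P\<close> the component partition of the edges inside its own classes.\<close>

lemma alt_sum_edge_set_pos:
  assumes G: "pair_graph G" and P: "equiv (pverts G) P" "F P > 0"
    and conn: "\<And>x y. (x, y) \<in> P \<Longrightarrow> (x, y) \<in> (parcs G \<inter> P)\<^sup>*"
    and F: "\<And>P. 0 \<le> F P" "\<And>P. F P \<noteq> 0 \<Longrightarrow> card (pverts G // P) = c"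
  shows "0 < (-1) ^ (card (pverts G) + c) * alt_sum F (pverts G) {} (edge_set G)"
proof -
  let ?V = "pverts G" and ?E = "edge_set G"
  note D = pair_graphD[OF G]
  have E: "?E \<subseteq> ?V \<times> ?V" using D(2) by (auto simp: edge_set_def)
  have Efin: "finite ?E" by (rule finite_subset[OF E]) (use D(1) in simp)
  have eq0: "eq_closure ?V {} = Id_on ?V" by (auto simp: eq_closure_def)
  have "?V // Id_on ?V = (\<lambda>x. {x}) ` ?V" by (auto simp: quotient_def)
  then have card0: "card (?V // eq_closure ?V {}) = card ?V"
    unfolding eq0 by (simp add: card_image)
  have symP: "sym P" using P(1) by (rule equivE)
  have PV: "P \<subseteq> ?V \<times> ?V" using P(1) by (rule equiv_type)
  have "(?E \<inter> P) \<union> (?E \<inter> P)\<inverse> = parcs G \<inter> P"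
    unfolding edge_set_sym_closure[OF G, symmetric] using symP by (auto dest: symD)
  then have "P \<subseteq> eq_closure ?V (?E \<inter> P)"
    using conn PV by (auto simp: eq_closure_def)
  moreover have "eq_closure ?V (?E \<inter> P) \<subseteq> P" by (rule eq_closure_least[OF P(1)]) simp
  ultimately have "P = eq_closure ?V ({} \<union> (?E \<inter> P))" by simp
  then have ex: "\<exists>P. equiv ?V P \<and> 0 < F P \<and> P = eq_closure ?V ({} \<union> (?E \<inter> P))"
    using P by blast
  have noloops: "?E \<inter> eq_closure ?V {} = {}" unfolding eq0 by (auto simp: edge_set_def)
  have "?E \<inter> eq_closure ?V {} = {} \<longrightarrow>
      (\<exists>P. equiv ?V P \<and> 0 < F P \<and> P = eq_closure ?V ({} \<union> (?E \<inter> P))) \<longrightarrow>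
      0 < (-1) ^ (card (?V // eq_closure ?V {}) + c) * alt_sum F ?V {} ?E"
    by (rule conjunct2[OF alt_sum_sign[OF Efin D(1) E empty_subsetI]]) (fact F)+
  with ex noloops show ?thesis unfolding card0 by blast
qed

text \<open>Connectedness realises the one-block partition, and the sign of the alternating sum
  cancels the sign of the coefficient of the power sum.\<close>

lemma e_coeff_single_csf_pos:
  assumes G: "G \<in> conn_graphs n"
  shows "e_coeff {#n#} (csf G) > 0"
proof -
  let ?V = "pverts G" and ?F = "\<lambda>P. of_bool (card (pverts G // P) = 1) :: rat"
  have pg: "pair_graph G" and n: "card ?V = n" and "Digraph_Component.connected (with_proj G)"
    using G by (simp_all add: conn_graphs_def)
  then have conn: "?V \<noteq> {}" "\<And>u v. u \<in> ?V \<Longrightarrow> v \<in> ?V \<Longrightarrow> (u, v) \<in> (parcs G)\<^sup>*"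
    using connected_iff_rtrancl by blast+
  note D = pair_graphD[OF pg]
  have n1: "n \<ge> 1" using conn(1) D(1) n by (metis One_nat_def Suc_leI card_gt_0_iff)
  have P: "equiv ?V (?V \<times> ?V)" by (rule equivI) (auto simp: refl_on_def sym_def trans_def)
  have "?V // (?V \<times> ?V) = {?V}" using conn(1) by (auto simp: quotient_def)
  then have "?F (?V \<times> ?V) > 0" by simp
  moreover have "parcs G \<inter> ?V \<times> ?V = parcs G" using D(2) by blast
  ultimately have "0 < (-1) ^ (card ?V + 1) * alt_sum ?F ?V {} (edge_set G)"
    by (intro alt_sum_edge_set_pos[OF pg P]) (use conn(2) in \<open>auto split: if_splits\<close>)
  moreover have "(-1) ^ (card ?V + 1) = ((-1) ^ (card ?V - 1) :: rat)"
    using n n1 by (cases n) simp_all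
  ultimately have "0 < (-1) ^ (card ?V - 1) * alt_sum ?F ?V {} (edge_set G)" by (simp only:)
  then have "0 < of_nat n * ((-1) ^ (card ?V - 1) * alt_sum ?F ?V {} (edge_set G))"
    using n1 by simp
  then show ?thesis using e_coeff_single_csf[OF pg conn(1)] n by (simp add: mult_ac)
qed

lemma size_image_card_quotient:
  assumes "image_mset card (mset_set (V // P)) = {#a, b#}"
  shows "card (V // P) = 2"
proof -
  have "size (image_mset card (mset_set (V // P))) = size {#a, b#}" by (simp only: assms)
  then show ?thesis by simp
qed

text \<open>The two-block partition with blocks \<open>A\<close> and \<open>B\<close> is realised by
  the edges inside them; both signs are \<open>(-1)\<close> to the number of vertices.\<close>

lemma pair_fun_csf_pos:
  fixes G :: "nat pair_pre_digraph"
  assumes G: "pair_graph G" and AB: "A \<inter> B = {}" "A \<union> B = pverts G" "A \<noteq> {}" "B \<noteq> {}"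
    and conn: "induced_conn G A" "induced_conn G B"
  shows "pair_fun (card A) (card B) (csf G) > 0"
proof -
  let ?V = "pverts G" and ?P = "A \<times> A \<union> B \<times> B"
  let ?F = "\<lambda>P. of_bool (image_mset card (mset_set (?V // P)) = {#card A, card B#}) :: rat"
  note D = pair_graphD[OF G]
  have fin: "finite A" "finite B" using D(1) AB(2) by (metis finite_Un)+
  have ge: "card A \<ge> 1" "card B \<ge> 1" using fin AB by (simp_all add: Suc_le_eq card_gt_0_iff)
  have sum: "card A + card B = card ?V" using card_Un_disjoint[OF fin AB(1)] AB(2) by simp
  have P: "equiv ?V ?P"
    unfolding AB(2)[symmetric]
    by (rule equivI) (use AB(1) in \<open>auto simp: refl_on_def sym_def trans_def\<close>)
  have cls: "?P `` {x} = A" if "x \<in> A" for x using that AB(1) by auto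
  have cls': "?P `` {x} = B" if "x \<in> B" for x using that AB(1) by auto
  have "?V // ?P = (\<lambda>x. ?P `` {x}) ` (A \<union> B)" unfolding AB(2)[symmetric] by (auto simp: quotient_def)
  also have "\<dots> = (\<lambda>x. ?P `` {x}) ` A \<union> (\<lambda>x. ?P `` {x}) ` B" by (rule image_Un)
  also have "(\<lambda>x. ?P `` {x}) ` A = {A}" using cls AB(3) by (metis (no_types, lifting) image_cong image_constant_conv)
  also have "(\<lambda>x. ?P `` {x}) ` B = {B}" using cls' AB(4) by (metis (no_types, lifting) image_cong image_constant_conv)
  finally have "?V // ?P = {A, B}" by auto
  moreover have "A \<noteq> B" using AB by blast
  ultimately have FP: "?F ?P > 0" by simp
  have sub: "(parcs G \<inter> A \<times> A)\<^sup>* \<subseteq> (parcs G \<inter> ?P)\<^sup>*" "(parcs G \<inter> B \<times> B)\<^sup>* \<subseteq> (parcs G \<inter> ?P)\<^sup>*"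
    by (rule rtrancl_mono, blast)+
  have "0 < (-1) ^ (card ?V + 2) * alt_sum ?F ?V {} (edge_set G)"
  proof (rule alt_sum_edge_set_pos[where F = ?F, OF G P FP])
    show "(x, y) \<in> (parcs G \<inter> ?P)\<^sup>*" if "(x, y) \<in> ?P" for x y
      using that conn sub unfolding induced_conn_def by blast
    show "card (?V // Q) = 2" if "?F Q \<noteq> 0" for Q
      by (rule size_image_card_quotient) (use that in \<open>auto split: if_splits\<close>)
  qed simp
  then have "0 < (-1) ^ card ?V * alt_sum ?F ?V {} (edge_set G)" by simp
  then have "0 < of_nat (card A * card B) * ((-1) ^ card ?V * alt_sum ?F ?V {} (edge_set G))"
    using ge by simp
  moreover have "pverts G \<noteq> {}" using AB by blast
  ultimately show ?thesis using pair_fun_csf[OF G _ ge sum] by (simp add: mult_ac)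
qed

text \<open>All edges meet in \<open>w\<close>, so a component without \<open>w\<close> is a single
  vertex. Two components of size at least 2 never occur, and each term of the alternating sum is
  0.\<close>

lemma pair_fun_csf_star:
  fixes G :: "nat pair_pre_digraph"
  assumes G: "pair_graph G" and w: "parcs G \<subseteq> {w} \<times> UNIV \<union> UNIV \<times> {w}" "w \<in> pverts G"
    and ab: "a \<ge> 2" "b \<ge> 2" "a + b = card (pverts G)"
  shows "pair_fun a b (csf G) = 0"
proof -
  let ?V = "pverts G"
  note D = pair_graphD[OF G]
  have "image_mset card (mset_set (?V // eq_closure ?V S)) \<noteq> {#a, b#}" if S: "S \<subseteq> edge_set G" for S
  proof
    let ?R = "eq_closure ?V S"
    assume im: "image_mset card (mset_set (?V // ?R)) = {#a, b#}"
    have R: "equiv ?V ?R" by (rule equiv_eq_closure)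
    have fin: "finite (?V // ?R)" by (rule finite_quotient_equiv[OF D(1) R])
    have big: "card C \<ge> 2" if "C \<in> ?V // ?R" for C
    proof -
      have "card C \<in># image_mset card (mset_set (?V // ?R))" using that fin by auto
      then show ?thesis unfolding im using ab by auto
    qed
    define W where "W = ?R `` {w}"
    have "card (?V // ?R) = 2" by (rule size_image_card_quotient[OF im])
    then have "?V // ?R \<noteq> {W}" by auto
    moreover have "W \<in> ?V // ?R" unfolding W_def using w(2) by (rule quotientI)
    ultimately obtain C where C: "C \<in> ?V // ?R" "C \<noteq> W" by blast
    have "W \<subseteq> ?V" using eq_closure_subset[of ?V S] by (auto simp: W_def)
    \<comment> \<open>The comparison relation has \<open>W\<close> as one class and singletons
      elsewhere; it bounds the closure of \<open>S\<close> from above.\<close>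
    then have "equiv ?V (Id_on ?V \<union> W \<times> W)"
      by (intro equivI) (auto simp: refl_on_def sym_def trans_def)
    moreover have "S \<subseteq> Id_on ?V \<union> W \<times> W"
    proof (rule subrelI)
      fix x y assume xy: "(x, y) \<in> S"
      have "(x, y) \<in> parcs G" using xy S by (auto simp: edge_set_def)
      have SV: "S \<subseteq> ?V \<times> ?V" using S D(2) by (auto simp: edge_set_def)
      then have "(x, y) \<in> ?R" using subset_eq_closure[OF SV] xy by blast
      moreover have "(y, x) \<in> ?R" using calculation R by (meson equiv_def symD)
      moreover have "(w, w) \<in> ?R" using w(2) R by (meson equiv_def refl_onD)
      moreover have "x = w \<or> y = w" using w(1) \<open>(x, y) \<in> parcs G\<close> by blast
      ultimately show "(x, y) \<in> Id_on ?V \<union> W \<times> W" by (auto simp: W_def)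
    qed
    ultimately have RW: "?R \<subseteq> Id_on ?V \<union> W \<times> W" by (rule eq_closure_least)
    have "finite C" "C \<noteq> {}" using quotient_block[OF D(1) R C(1)] by auto
    have "C \<inter> W = {}" using quotient_disj[OF R C(1) \<open>W \<in> ?V // ?R\<close>] C(2) by blast
    have "x = y" if "x \<in> C" "y \<in> C" for x y
    proof -
      have "(x, y) \<in> ?R" using quotient_eq_iff[OF R C(1) C(1) that] by simp
      then show ?thesis using RW that \<open>C \<inter> W = {}\<close> by blast
    qed
    then have "card C \<le> 1" using \<open>finite C\<close> by (simp add: card_le_Suc0_iff_eq)
    then show False using big[OF C(1)] by simp
  qed
  then have "alt_sum (\<lambda>P. of_bool (image_mset card (mset_set (?V // P)) = {#a, b#})) ?V {} (edge_set G) = 0"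
    unfolding alt_sum_def by (intro sum.neutral) auto
  moreover have "?V \<noteq> {}" using w by blast
  ultimately show ?thesis using pair_fun_csf[OF G, of a b] ab by simp
qed

section \<open>The coefficient at \<open>(2,1,...,1)\<close> as a monomial coefficient\<close>

lemma size_lead_mono: "size (lead_mono lam) = \<Sum>\<^sub># lam"
  by (induction lam) auto

lemma lead_mono_positive: "x \<in># lead_mono lam \<Longrightarrow> x \<ge> 1"
  by (induction lam) auto

lemma sum_mset_ge_size:
  assumes "\<And>x. x \<in># M \<Longrightarrow> (x::nat) \<ge> 1"
  shows "size M \<le> \<Sum>\<^sub># M" "\<Sum>\<^sub># M = size M \<Longrightarrow> M = replicate_mset (size M) 1"
proof -
  have "size M \<le> \<Sum>\<^sub># M \<and> (\<Sum>\<^sub># M = size M \<longrightarrow> M = replicate_mset (size M) 1)"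
    using assms
  proof (induction M)
    case (add x M)
    have x: "x \<ge> 1" using add.prems by simp
    have IH: "size M \<le> \<Sum>\<^sub># M" "\<Sum>\<^sub># M = size M \<Longrightarrow> M = replicate_mset (size M) 1"
      using add by simp_all
    have "add_mset x M = replicate_mset (size (add_mset x M)) 1"
      if "\<Sum>\<^sub># (add_mset x M) = size (add_mset x M)"
    proof -
      have "x = 1" "\<Sum>\<^sub># M = size M" using that x IH(1) by simp_all
      with IH(2) show ?thesis by simp
    qed
    moreover have "size (add_mset x M) \<le> \<Sum>\<^sub># (add_mset x M)" using x IH(1) by simp
    ultimately show ?case by blast
  qed simp
  then show "size M \<le> \<Sum>\<^sub># M" "\<Sum>\<^sub># M = size M \<Longrightarrow> M = replicate_mset (size M) 1" by auto
qed

lemma lead_mono_replicate: "lead_mono (replicate_mset n 1) = replicate_mset n 1"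
  by (induction n) auto

lemma mcoeff_e_expandable:
  assumes "e_expandable F"
  shows "mcoeff F M = (\<Sum>lam | e_coeff lam F \<noteq> 0. e_coeff lam F * mcoeff (e_basis lam) M)"
proof -
  have "F = (\<Sum>lam | e_coeff lam F \<noteq> 0. e_coeff lam F *\<^sub>s e_basis lam)"
    by (rule e_expansion_support(4)[OF e_expansion_e_coeff[OF assms] refl])
  from arg_cong[OF this, of "\<lambda>F. mcoeff F M"] show ?thesis
    by (simp add: mcoeff_sum smult_series.rep_eq)
qed

text \<open>Triangularity in the two lowest index sums. The vanishing coefficient of the monomial
  with \<open>n\<close> ones removes the partition into ones; then only \<open>(2,1,...,1)\<close>
  contributes to its own leading monomial, with coefficient 1.\<close>

lemma e_coeff_two_ones:
  assumes F: "e_expandable F" and zero: "mcoeff F (replicate_mset n 1) = 0" and n: "n \<ge> 2"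
  shows "e_coeff (add_mset 2 (replicate_mset (n - 2) 1)) F =
    mcoeff F (add_mset 2 (replicate_mset (n - 1) 1))"
proof -
  let ?o = "replicate_mset n 1 :: nat multiset" and ?t = "add_mset 2 (replicate_mset (n - 2) 1) :: nat multiset"
  let ?M = "add_mset 2 (replicate_mset (n - 1) 1) :: nat multiset"
  let ?K = "{lam. e_coeff lam F \<noteq> 0}"
  note supp = e_expansion_support[OF e_expansion_e_coeff[OF F] refl]
  obtain m where m: "n = Suc (Suc m)" using n by (metis add_2_eq_Suc le_Suc_ex)
  have po: "is_partition ?o" and pt: "is_partition ?t" by (auto simp: is_partition_def)
  have lt: "lead_mono ?t = ?M"
    unfolding lead_mono_simps lead_mono_replicate by (simp add: m numeral_2_eq_2 atLeastAtMostSuc_conv)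
  \<comment> \<open>A leading monomial of degree \<open>n\<close> and index sum at most
    \<open>n\<close> has all indices equal to 1.\<close>
  have ones: "lam = ?o" if "is_partition lam" "\<Sum>\<^sub># lam = n" "\<Sum>\<^sub># (lead_mono lam) \<le> n" for lam
  proof -
    have "lead_mono lam = replicate_mset n 1"
      using sum_mset_ge_size[of "lead_mono lam"] lead_mono_positive[of _ lam] that(2,3)
      by (simp add: size_lead_mono)
    then have "lead_mono lam = lead_mono ?o" by (simp only: lead_mono_replicate)
    then show ?thesis using lead_mono_inj[OF that(1) po] by simp
  qed
  have "mcoeff (e_basis lam) ?o = 0" if "lam \<in> ?K - {?o}" for lam
  proof (rule ccontr)
    assume "mcoeff (e_basis lam) ?o \<noteq> 0"
    from e_basis_mcoeff_nonzero[OF this] have "\<Sum>\<^sub># lam = n" "\<Sum>\<^sub># (lead_mono lam) \<le> n"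
      by auto
    then show False using ones[of lam] supp(2)[of lam] that by blast
  qed
  then have "(\<Sum>lam\<in>?K. e_coeff lam F * mcoeff (e_basis lam) ?o) =
      (\<Sum>lam\<in>?K \<inter> {?o}. e_coeff lam F * mcoeff (e_basis lam) ?o)"
    by (intro sum.mono_neutral_right supp(1)) auto
  also have "\<dots> = e_coeff ?o F"
    using e_basis_mcoeff_lead[of ?o, unfolded lead_mono_replicate] by (cases "e_coeff ?o F = 0") simp_all
  finally have o0: "e_coeff ?o F = 0" using zero mcoeff_e_expandable[OF F, of ?o] by simp
  have "mcoeff (e_basis lam) ?M = 0" if "lam \<in> ?K - {?t}" for lam
  proof (rule ccontr)
    assume "mcoeff (e_basis lam) ?M \<noteq> 0"
    note nz = e_basis_mcoeff_nonzero[OF this]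
    \<comment> \<open>The index sum of \<open>?M\<close> is \<open>n + 1\<close>, so only partitions
      whose leading monomial has index sum at most \<open>n + 1\<close> can contribute.\<close>
    have M: "\<Sum>\<^sub># ?M = Suc n" "size ?M = n" using m by simp_all
    have l: "\<Sum>\<^sub># lam = n" "\<Sum>\<^sub># (lead_mono lam) \<le> Suc n"
      "\<Sum>\<^sub># (lead_mono lam) = Suc n \<Longrightarrow> lead_mono lam = ?M"
      using nz unfolding M by metis+
    have p: "is_partition lam" using supp(2)[of lam] that by blast
    show False
    proof (cases "\<Sum>\<^sub># (lead_mono lam) = Suc n")
      case True
      then have "lam = ?t" using lead_mono_inj[OF p pt] l(3) lt by simp
      then show False using that by blast
    next
      case False
      then have "lam = ?o" using ones[OF p] l by simp
      then show False using that o0 by simp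
    qed
  qed
  then have "(\<Sum>lam\<in>?K. e_coeff lam F * mcoeff (e_basis lam) ?M) =
      (\<Sum>lam\<in>?K \<inter> {?t}. e_coeff lam F * mcoeff (e_basis lam) ?M)"
    by (intro sum.mono_neutral_right supp(1)) auto
  also have "\<dots> = e_coeff ?t F"
    using e_basis_mcoeff_lead[of ?t, unfolded lt] by (cases "e_coeff ?t F = 0") simp_all
  finally show ?thesis using mcoeff_e_expandable[OF F, of ?M] by simp
qed

lemma mcoeff_csf_eq_0:
  "(\<And>\<kappa>. \<kappa> \<in> proper_colorings G \<Longrightarrow> image_mset \<kappa> (mset_set (pverts G)) \<noteq> M) \<Longrightarrow> mcoeff (csf G) M = 0"
  by (simp add: csf.rep_eq card_eq_0_iff)

text \<open>This monomial would need every vertex to have colour 1, which an edge forbids.\<close>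

lemma mcoeff_csf_ones:
  assumes G: "pair_graph G" and e: "(u, v) \<in> parcs G"
  shows "mcoeff (csf G) (replicate_mset n 1) = 0"
proof (rule mcoeff_csf_eq_0, rule notI)
  fix \<kappa> assume \<kappa>: "\<kappa> \<in> proper_colorings G"
    "image_mset \<kappa> (mset_set (pverts G)) = replicate_mset n 1"
  note D = pair_graphD[OF G]
  have "\<kappa> x = 1" if "x \<in> pverts G" for x
  proof -
    have "\<kappa> x \<in># image_mset \<kappa> (mset_set (pverts G))" using that D(1) by simp
    then show ?thesis unfolding \<kappa>(2) by (simp split: if_splits)
  qed
  then have "\<kappa> u = \<kappa> v" using e D(2) by auto
  then show False using \<kappa>(1) e by (auto simp: proper_colorings_def)
qed

text \<open>With colours 1 and 2 only, each edge has an end of colour 2. Disjoint edges have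
  distinct such ends, but the monomial provides only one.\<close>

lemma mcoeff_csf_disjoint_edges:
  assumes G: "pair_graph G" and e: "(a, b) \<in> parcs G" "(c, d) \<in> parcs G" "{a, b} \<inter> {c, d} = {}"
  shows "mcoeff (csf G) (add_mset 2 (replicate_mset n 1)) = 0"
proof (rule mcoeff_csf_eq_0, rule notI)
  fix \<kappa> assume \<kappa>: "\<kappa> \<in> proper_colorings G"
    "image_mset \<kappa> (mset_set (pverts G)) = add_mset 2 (replicate_mset n 1)"
  note D = pair_graphD[OF G]
  have col: "\<kappa> x = 1 \<or> \<kappa> x = 2" if "x \<in> pverts G" for x
  proof -
    have "\<kappa> x \<in># image_mset \<kappa> (mset_set (pverts G))" using that D(1) by simp
    then show ?thesis unfolding \<kappa>(2) by (auto split: if_splits)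
  qed
  have edge: "\<exists>x\<in>{u, v}. x \<in> pverts G \<and> \<kappa> x = 2" if "(u, v) \<in> parcs G" for u v
  proof -
    have "\<kappa> u \<noteq> \<kappa> v" using \<kappa>(1) that by (auto simp: proper_colorings_def)
    moreover have "u \<in> pverts G" "v \<in> pverts G" using that D(2) by auto
    ultimately show ?thesis using col[of u] col[of v] by auto
  qed
  obtain x y where xy: "x \<in> {a, b}" "y \<in> {c, d}" "x \<in> pverts G" "y \<in> pverts G" "\<kappa> x = 2" "\<kappa> y = 2"
    using edge[OF e(1)] edge[OF e(2)] by blast
  then have "x \<noteq> y" using e(3) by blast
  have "{#x, y#} \<subseteq># mset_set (pverts G)"
  proof -
    have "{#x, y#} = mset_set {x, y}" using \<open>x \<noteq> y\<close> by simp
    also have "\<dots> \<subseteq># mset_set (pverts G)" by (rule subset_imp_msubset_mset_set) (use xy D(1) in auto)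
    finally show ?thesis .
  qed
  then have "image_mset \<kappa> {#x, y#} \<subseteq># add_mset 2 (replicate_mset n 1)"
    unfolding \<kappa>(2)[symmetric] by (rule image_mset_subseteq_mono)
  then have "{#2, 2#} \<subseteq># add_mset 2 (replicate_mset n (1::nat))" using xy by simp
  from mset_subset_eq_count[OF this, of 2] show False by simp
qed

section \<open>Stars\<close>

lemma star_graph_conn:
  assumes "n \<ge> 2"
  shows "star_graph n \<in> conn_graphs n"
proof -
  let ?S = "star_graph n"
  have pg: "pair_graph ?S"
    by unfold_locales (use assms in \<open>auto simp: star_graph_def symmetric_def intro!: symI\<close>)
  have "(u, n) \<in> (parcs ?S)\<^sup>*" "(n, u) \<in> (parcs ?S)\<^sup>*" if "u \<in> pverts ?S" for u
    using that by (cases "u = n"; auto simp: star_graph_def intro!: r_into_rtrancl)+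
  then have "(u, v) \<in> (parcs ?S)\<^sup>*" if "u \<in> pverts ?S" "v \<in> pverts ?S" for u v
    using that by (meson rtrancl_trans)
  moreover have "pverts ?S \<noteq> {}" using assms by (simp add: star_graph_def)
  ultimately have "Digraph_Component.connected (with_proj ?S)"
    unfolding connected_iff_rtrancl[OF pg] by blast
  then show ?thesis using pg by (simp add: conn_graphs_def star_graph_def)
qed

lemma csf_eq_gen_series:
  "csf G = gen_series (proper_colorings G) (\<lambda>\<kappa>. image_mset \<kappa> (mset_set (pverts G)))"
  by (rule series_eqI) (simp add: csf.rep_eq mcoeff_gen_series)

text \<open>Colorings of \<open>H\<close> are pulled back along \<phi>; restricting to the vertex
  set keeps them extensional and makes the pullback invertible.\<close>

lemma csf_iso:
  assumes bij: "bij_betw \<phi> (pverts G) (pverts H)"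
    and sub: "parcs G \<subseteq> pverts G \<times> pverts G"
    and arcs: "parcs H = map_prod \<phi> \<phi> ` parcs G"
  shows "csf H = csf G"
  unfolding csf_eq_gen_series
proof (rule gen_series_reindex)
  let ?V = "pverts G" and ?W = "pverts H"
  let ?h = "\<lambda>\<kappa> :: _ \<Rightarrow> nat. restrict (\<kappa> \<circ> \<phi>) ?V"
  let ?\<psi> = "inv_into ?V \<phi>"
  let ?k = "\<lambda>\<kappa> :: _ \<Rightarrow> nat. restrict (\<kappa> \<circ> ?\<psi>) ?W"
  have \<phi>: "\<phi> v \<in> ?W" "?\<psi> (\<phi> v) = v" if "v \<in> ?V" for v
    using that bij by (auto simp: bij_betw_def)
  have \<psi>: "?\<psi> w \<in> ?V" "\<phi> (?\<psi> w) = w" if "w \<in> ?W" for w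
    using that bij by (auto simp: bij_betw_def inv_into_into f_inv_into_f)
  have pcG: "\<kappa> \<in> proper_colorings G \<longleftrightarrow> \<kappa> \<in> extensional ?V \<and>
      (\<forall>v\<in>?V. \<kappa> v \<ge> 1) \<and> (\<forall>u v. (u, v) \<in> parcs G \<longrightarrow> \<kappa> u \<noteq> \<kappa> v)" for \<kappa>
    by (auto simp: proper_colorings_def PiE_def Pi_def)
  have pcH: "\<kappa> \<in> proper_colorings H \<longleftrightarrow> \<kappa> \<in> extensional ?W \<and>
      (\<forall>v\<in>?W. \<kappa> v \<ge> 1) \<and> (\<forall>u v. (u, v) \<in> parcs G \<longrightarrow> \<kappa> (\<phi> u) \<noteq> \<kappa> (\<phi> v))" for \<kappa>
    unfolding proper_colorings_def arcs by (auto simp: PiE_def Pi_def)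
  have inV: "u \<in> ?V" "v \<in> ?V" if "(u, v) \<in> parcs G" for u v using that sub by auto
  show "bij_betw ?h (proper_colorings H) (proper_colorings G)"
  proof (rule bij_betw_byWitness[where f' = ?k])
    show "\<forall>\<kappa>\<in>proper_colorings H. ?k (?h \<kappa>) = \<kappa>"
    proof
      fix \<kappa> assume "\<kappa> \<in> proper_colorings H"
      then have "\<kappa> \<in> extensional ?W" unfolding pcH by blast
      then show "?k (?h \<kappa>) = \<kappa>" by (intro extensionalityI[of _ ?W]) (simp_all add: \<psi>)
    qed
    show "\<forall>\<kappa>\<in>proper_colorings G. ?h (?k \<kappa>) = \<kappa>"
    proof
      fix \<kappa> assume "\<kappa> \<in> proper_colorings G"
      then have "\<kappa> \<in> extensional ?V" unfolding pcG by blast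
      then show "?h (?k \<kappa>) = \<kappa>" by (intro extensionalityI[of _ ?V]) (simp_all add: \<phi>)
    qed
    show "?h ` proper_colorings H \<subseteq> proper_colorings G"
    proof (rule image_subsetI)
      fix \<kappa> assume "\<kappa> \<in> proper_colorings H"
      then show "?h \<kappa> \<in> proper_colorings G" unfolding pcG pcH using inV \<phi>(1) by simp
    qed
    show "?k ` proper_colorings G \<subseteq> proper_colorings H"
    proof (rule image_subsetI)
      fix \<kappa> assume "\<kappa> \<in> proper_colorings G"
      then show "?k \<kappa> \<in> proper_colorings H" unfolding pcG pcH using inV \<phi> \<psi>(1) by simp
    qed
  qed
  fix \<kappa> :: "_ \<Rightarrow> nat"
  show "image_mset (?h \<kappa>) (mset_set ?V) = image_mset \<kappa> (mset_set ?W)"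
  proof (cases "finite ?V")
    case True
    have "mset_set ?W = image_mset \<phi> (mset_set ?V)"
      using bij by (simp add: bij_betw_def image_mset_mset_set)
    then show ?thesis using True by (auto simp: multiset.map_comp intro!: image_mset_cong)
  next
    case False
    then have "infinite ?W" using bij bij_betw_finite by blast
    with False show ?thesis by simp
  qed
qed

lemma csf_star:
  assumes fin: "finite (pverts G)" and w: "w \<in> pverts G"
    and arcs: "parcs G = {w} \<times> (pverts G - {w}) \<union> (pverts G - {w}) \<times> {w}"
  shows "csf G = csf (star_graph (card (pverts G)))"
proof -
  let ?n = "card (pverts G)"
  have n: "?n \<ge> 1" using fin w by (metis One_nat_def Suc_leI card_gt_0_iff empty_iff)
  have "card (pverts G - {w}) = card {1..?n - 1}" using fin w by simp
  then obtain f where f: "bij_betw f (pverts G - {w}) {1..?n - 1}"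
    using finite_same_card_bij[of "pverts G - {w}" "{1..?n - 1}"] fin by auto
  \<comment> \<open>The centre goes to \<open>?n\<close> and the leaves go bijectively to the
    smaller labels.\<close>
  define \<phi> where "\<phi> = f(w := ?n)"
  have im: "\<phi> ` (pverts G - {w}) = {1..?n - 1}" using f by (auto simp: \<phi>_def bij_betw_def)
  have "bij_betw \<phi> (pverts G - {w}) {1..?n - 1}"
    using f by (rule bij_betw_cong[THEN iffD1, rotated]) (simp add: \<phi>_def)
  moreover have "bij_betw \<phi> {w} {?n}" by (simp add: \<phi>_def bij_betw_def)
  ultimately have "bij_betw \<phi> (pverts G - {w} \<union> {w}) ({1..?n - 1} \<union> {?n})"
    by (rule bij_betw_combine) (use n in auto)
  moreover have "pverts G - {w} \<union> {w} = pverts G" using w by blast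
  moreover have "{1..?n - 1} \<union> {?n} = pverts (star_graph ?n)" using n by (auto simp: star_graph_def)
  ultimately have bij: "bij_betw \<phi> (pverts G) (pverts (star_graph ?n))" by simp
  have "map_prod \<phi> \<phi> ` parcs G = \<phi> ` {w} \<times> \<phi> ` (pverts G - {w}) \<union> \<phi> ` (pverts G - {w}) \<times> \<phi> ` {w}"
    unfolding arcs image_Un by (simp only: map_prod_surj_on[OF refl refl])
  also have "\<dots> = parcs (star_graph ?n)" unfolding im by (simp add: star_graph_def \<phi>_def)
  finally have "parcs (star_graph ?n) = map_prod \<phi> \<phi> ` parcs G" by simp
  moreover have "parcs G \<subseteq> pverts G \<times> pverts G" using w unfolding arcs by blast
  ultimately show ?thesis using csf_iso[OF bij] by simp
qed

lemma mcoeff_csf_star_pos: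
  assumes "n \<ge> 2"
  shows "mcoeff (csf (star_graph n)) (add_mset 2 (replicate_mset (n - 1) 1)) > 0"
proof -
  let ?S = "star_graph n" and ?M = "add_mset 2 (replicate_mset (n - 1) 1)"
  have V: "pverts ?S = insert n {1..n - 1}" using assms by (auto simp: star_graph_def)
  \<comment> \<open>The centre gets colour 2 and every leaf colour 1; one such coloring suffices for
    positivity.\<close>
  define \<kappa> where "\<kappa> = (\<lambda>v\<in>pverts ?S. if v = n then 2 else 1 :: nat)"
  have "\<kappa> \<in> proper_colorings ?S"
    using assms by (auto simp: proper_colorings_def \<kappa>_def star_graph_def split: if_splits)
  moreover have "image_mset \<kappa> (mset_set (pverts ?S)) = ?M"
  proof -
    have "image_mset \<kappa> (mset_set {1..n - 1}) = image_mset (\<lambda>_. 1) (mset_set {1..n - 1})"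
      by (rule image_mset_cong) (use assms in \<open>auto simp: \<kappa>_def V\<close>)
    moreover have "\<kappa> n = 2" using V by (simp add: \<kappa>_def)
    moreover have "n \<notin> {1..n - 1}" using assms by auto
    ultimately show ?thesis unfolding V by (simp add: image_mset_const_eq)
  qed
  ultimately have "\<kappa> \<in> {\<kappa> \<in> proper_colorings ?S. image_mset \<kappa> (mset_set (pverts ?S)) = ?M}" by simp
  moreover have "finite {\<kappa> \<in> proper_colorings ?S. image_mset \<kappa> (mset_set (pverts ?S)) = ?M}"
    by (rule finite_subset[OF _ finite_colorings_fibre[of "pverts ?S" ?M]])
      (auto simp: proper_colorings_def V)
  ultimately show ?thesis by (auto simp: csf.rep_eq card_gt_0_iff)
qed

section \<open>Incomparability of the star with every other class\<close>

theorem proposition3p13: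
  fixes n :: nat
  assumes "n \<ge> 4"
  shows "independent_element (E_elements n) (E_order n) (csf_equiv n `` {star_graph n})"
proof -
  let ?S = "star_graph n"
  have S: "?S \<in> conn_graphs n" using assms by (intro star_graph_conn) simp
  then have pgS: "pair_graph ?S" and cardS: "card (pverts ?S) = n" by (simp_all add: conn_graphs_def)
  have exS: "e_expandable (csf ?S)" by (rule csf_e_expandable[OF pgS])
  have posS: "e_coeff {#n#} (csf ?S) > 0" by (rule e_coeff_single_csf_pos[OF S])
  have main: "\<not> e_positive (X_e ?S H) \<and> \<not> e_positive (X_e H ?S)"
    if H: "H \<in> conn_graphs n" and ne: "csf H \<noteq> csf ?S" for H
  proof -
    have pgH: "pair_graph H" and cardH: "card (pverts H) = n" using H by (simp_all add: conn_graphs_def)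
    note D = pair_graphD[OF pgH]
    have exH: "e_expandable (csf H)" by (rule csf_e_expandable[OF pgH])
    have posH: "e_coeff {#n#} (csf H) > 0" by (rule e_coeff_single_csf_pos[OF H])
    \<comment> \<open>All stars on \<open>n\<close> vertices share one chromatic symmetric function,
      so \<open>H\<close> is not a star.\<close>
    have "\<exists>a b c d. (a, b) \<in> parcs H \<and> (c, d) \<in> parcs H \<and> {a, b} \<inter> {c, d} = {}"
    proof (rule ccontr)
      assume "\<not> ?thesis"
      then obtain w where w: "w \<in> pverts H"
        "parcs H = {w} \<times> (pverts H - {w}) \<union> (pverts H - {w}) \<times> {w}"
        using star_if_no_disjoint_edges[OF H assms] by metis
      then show False using csf_star[OF D(1) w] cardH ne by simp
    qed
    then obtain a b c d where e: "(a, b) \<in> parcs H" "(c, d) \<in> parcs H" "{a, b} \<inter> {c, d} = {}"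
      by blast

    \<comment> \<open>At \<open>(2,1,...,1)\<close> the coefficient is 0 for \<open>H\<close> and
      positive for the star, which refutes positivity of \<open>X_e H ?S\<close>.\<close>
    let ?t = "add_mset 2 (replicate_mset (n - 2) 1) :: nat multiset"
    have n2: "n \<ge> 2" using assms by simp
    have eS: "(n, 1) \<in> parcs ?S" using assms by (simp add: star_graph_def)
    have tH: "e_coeff ?t (csf H) = 0"
      using e_coeff_two_ones[OF exH mcoeff_csf_ones[OF pgH e(1)] n2]
        mcoeff_csf_disjoint_edges[OF pgH e] by simp
    have tS: "e_coeff ?t (csf ?S) > 0"
      using e_coeff_two_ones[OF exS mcoeff_csf_ones[OF pgS eS] n2] mcoeff_csf_star_pos[OF n2] by simp
    have "e_coeff ?t (X_e H ?S) =
        e_coeff ?t (csf H) - e_coeff {#n#} (csf H) / e_coeff {#n#} (csf ?S) * e_coeff ?t (csf ?S)"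
      using exH exS by (simp add: X_e_def cardH cardS e_coeff_diff e_coeff_smult e_expandable_smult)
    then have "e_coeff ?t (X_e H ?S) = - (e_coeff {#n#} (csf H) / e_coeff {#n#} (csf ?S) * e_coeff ?t (csf ?S))"
      by (simp only: tH diff_0)
    then have "e_coeff ?t (X_e H ?S) < 0" using posH posS tS by simp
    moreover have "is_partition ?t" by (auto simp: is_partition_def)
    ultimately have 1: "\<not> e_positive (X_e H ?S)" unfolding e_positive_def by (meson not_le)

    \<comment> \<open>For the other direction the two disjoint edges grow into connected parts
      \<open>A\<close> and \<open>B\<close>, each with at least two vertices.\<close>
    have sub: "{a, b} \<union> {c, d} \<subseteq> pverts H" using e D(2) by auto
    obtain A B where AB: "{a, b} \<subseteq> A" "{c, d} \<subseteq> B" "A \<inter> B = {}" "A \<union> B = pverts H"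
      "induced_conn H A" "induced_conn H B"
      using extend_connected_pair[OF H e(3) sub insert_not_empty induced_conn_edge[OF e(1) D(3)]
          induced_conn_edge[OF e(2) D(3)]] by metis
    have fin: "finite A" "finite B" using D(1) AB(4) by (metis finite_Un)+
    have "a \<noteq> b" "c \<noteq> d" using e(1,2) D(4) by auto
    then have ge: "card A \<ge> 2" "card B \<ge> 2"
      using card_mono[OF fin(1) AB(1)] card_mono[OF fin(2) AB(2)] by simp_all
    have sum: "card A + card B = n" using card_Un_disjoint[OF fin AB(3)] AB(4) cardH by simp
    \<comment> \<open>The ratio \<open>r\<close> depends only on the two sizes, so
      \<open>pair_fun\<close> is the same linear form for \<open>H\<close> and the star.\<close>
    define r where "r = e_coeff {#card A, card B#} (power_sum n) / e_coeff {#n#} (power_sum n)"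
    have pf: "pair_fun (card A) (card B) F = e_coeff {#card A, card B#} F - r * e_coeff {#n#} F" for F
      by (simp add: pair_fun_def r_def sum)
    have "A \<noteq> {}" "B \<noteq> {}" using AB by auto
    then have pH: "e_coeff {#card A, card B#} (csf H) - r * e_coeff {#n#} (csf H) > 0"
      using pair_fun_csf_pos[OF pgH AB(3,4) _ _ AB(5,6)] pf by simp
    have "pair_fun (card A) (card B) (csf ?S) = 0"
      by (rule pair_fun_csf_star[OF pgS _ _ ge, of n])
        (use assms sum cardS in \<open>auto simp: star_graph_def\<close>)
    then have pS: "e_coeff {#card A, card B#} (csf ?S) = r * e_coeff {#n#} (csf ?S)"
      unfolding pf by simp
    have "e_coeff {#card A, card B#} (X_e ?S H) = e_coeff {#card A, card B#} (csf ?S) -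
        e_coeff {#n#} (csf ?S) / e_coeff {#n#} (csf H) * e_coeff {#card A, card B#} (csf H)"
      using exH exS by (simp add: X_e_def cardH cardS e_coeff_diff e_coeff_smult e_expandable_smult)
    \<comment> \<open>Inserting the vanishing on the star leaves a negative multiple of the positive
      value of \<open>pair_fun\<close> on \<open>H\<close>.\<close>
    also have "\<dots> = - (e_coeff {#n#} (csf ?S) / e_coeff {#n#} (csf H) *
        (e_coeff {#card A, card B#} (csf H) - r * e_coeff {#n#} (csf H)))"
      unfolding pS using posH by (simp add: field_simps)
    also have "\<dots> < 0" using pH posH posS by simp
    finally have "e_coeff {#card A, card B#} (X_e ?S H) < 0" .
    moreover have "is_partition {#card A, card B#}" using ge by (auto simp: is_partition_def)
    ultimately have 2: "\<not> e_positive (X_e ?S H)" unfolding e_positive_def by (meson not_le)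
    show ?thesis using 1 2 by blast
  qed
  show ?thesis
    unfolding independent_element_def
  proof (intro conjI ballI impI)
    show "csf_equiv n `` {?S} \<in> E_elements n" unfolding E_elements_def using S by (rule quotientI)
  next
    fix y assume y: "y \<in> E_elements n" "y \<noteq> csf_equiv n `` {?S}"
    then obtain H where H: "H \<in> conn_graphs n" "y = csf_equiv n `` {H}"
      unfolding E_elements_def by (meson quotientE)
    have "csf H \<noteq> csf ?S"
    proof
      assume "csf H = csf ?S"
      then have "csf_equiv n `` {H} = csf_equiv n `` {?S}" using H(1) S by (auto simp: csf_equiv_def)
      then show False using y(2) H(2) by simp
    qed
    note * = main[OF H(1) this]
    show "(csf_equiv n `` {?S}, y) \<notin> E_order n" "(y, csf_equiv n `` {?S}) \<notin> E_order n"
      unfolding H(2) E_order_class_iff[OF H(1) S] E_order_class_iff[OF S H(1)] using * by blast+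
  qed
qed

end
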